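(* Let $q,d,M\in\mathbb{N}$, $D=(2q+1)^d$, and let $N$ be a prime number with $$N\ge\max\{2q+1,\ (d-1)^2(2M-1)^2+1\}.$$ Let $X=\{x_1,\ldots,x_N\}$ with $x_j=(j,j^2,\ldots,j^d)/N \bmod 1$, $j=1,\ldots,N$, and let $\mathcal F_X$ be the $N\times D$ matrix with entries $(\mathcal F_X)_{j,k}=\exp(2\pi i\,k\cdot x_j)$, $k\in[-q,q]^d\cap\mathbb{Z}^d$. Then for every $f\in\Pi_q^d(M)$ with coefficient vector $c$, given the samples $y=(f(x_j))_{j=1}^N=\mathcal F_X c$: (i) Orthogonal Matching Pursuit run for $M$ iterations with input $\mathcal F_X$ and $y$ returns exactly $c$; and (ii) Basis Pursuit, i.e. the problem $\min\{\|z\|_1: z\in\mathbb{C}^D,\ \mathcal F_X z=y\}$, has $c$ as its unique solution.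
   Context: $\Pi_q^d$ is the space of trigonometric polynomials $f(x)=\sum_{k\in[-q,q]^d\cap\mathbb{Z}^d}c_k e^{2\pi i k\cdot x}$, $x\in[0,1]^d$, $c_k\in\mathbb{C}$. For $T\subset[-q,q]^d\cap\mathbb{Z}^d$, $\Pi_T$ denotes those $f$ with $c_k=0$ for $k\notin T$, and $\Pi_q^d(M)=\bigcup_{|T|\le M}\Pi_T$ (the $M$-sparse trigonometric polynomials). Orthogonal Matching Pursuit (OMP): set $r^0=y$, $\Lambda^0=\emptyset$; for $\ell=0,1,\ldots,M-1$: compute $h^\ell=\mathcal F_X^* r^\ell$ ($\mathcal F_X^*$ the conjugate transpose), set $\Lambda^{\ell+1}=\Lambda^\ell\cup\{\arg\max_k |h^\ell(k)|\}$, let $c^{\ell+1}=\arg\min_{z:\,\mathrm{supp}(z)\subset\Lambda^{\ell+1}}\|y-\mathcal F_X z\|_2$, and $r^{\ell+1}=y-\mathcal F_X c^{\ell+1}$; output $c^M$. *)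

theory Defs
  imports Complex_Main "HOL-Computational_Algebra.Primes"
begin

type_synonym freq = "int list"

definition freqs :: "nat \<Rightarrow> nat \<Rightarrow> freq set" where
  "freqs q d = {k. length k = d \<and> (\<forall>i<d. - int q \<le> k ! i \<and> k ! i \<le> int q)}"

text \<open>Rank-1 lattice-type nodes: x_j = (j, j^2, ..., j^d)/N mod 1; component i (0-based) is (j^(i+1) mod N)/N.\<close>
definition node :: "nat \<Rightarrow> nat \<Rightarrow> nat \<Rightarrow> real" where
  "node N j i = real (j ^ (Suc i) mod N) / real N"

definition dotx :: "nat \<Rightarrow> nat \<Rightarrow> freq \<Rightarrow> nat \<Rightarrow> real" where
  "dotx N d k j = (\<Sum>i<d. real_of_int (k ! i) * node N j i)"

definition FX :: "nat \<Rightarrow> nat \<Rightarrow> nat \<Rightarrow> freq \<Rightarrow> complex" where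
  "FX N d j k = exp (2 * of_real pi * \<i> * of_real (dotx N d k j))"

definition FXmul :: "nat \<Rightarrow> nat \<Rightarrow> nat \<Rightarrow> (freq \<Rightarrow> complex) \<Rightarrow> nat \<Rightarrow> complex" where
  "FXmul q d N z j = (\<Sum>k\<in>freqs q d. FX N d j k * z k)"

definition FXadj :: "nat \<Rightarrow> nat \<Rightarrow> (nat \<Rightarrow> complex) \<Rightarrow> freq \<Rightarrow> complex" where
  "FXadj d N r k = (\<Sum>j=1..N. cnj (FX N d j k) * r j)"

definition norm2 :: "nat \<Rightarrow> (nat \<Rightarrow> complex) \<Rightarrow> real" where
  "norm2 N v = sqrt (\<Sum>j=1..N. (cmod (v j))\<^sup>2)"

definition norm1 :: "nat \<Rightarrow> nat \<Rightarrow> (freq \<Rightarrow> complex) \<Rightarrow> real" where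
  "norm1 q d z = (\<Sum>k\<in>freqs q d. cmod (z k))"

definition trig_poly :: "nat \<Rightarrow> nat \<Rightarrow> (freq \<Rightarrow> complex) \<Rightarrow> (nat \<Rightarrow> real) \<Rightarrow> complex" where
  "trig_poly q d c x = (\<Sum>k\<in>freqs q d. c k * exp (2 * of_real pi * \<i> * of_real (\<Sum>i<d. real_of_int (k ! i) * x i)))"

definition sparse_coeffs :: "nat \<Rightarrow> nat \<Rightarrow> nat \<Rightarrow> (freq \<Rightarrow> complex) set" where
  "sparse_coeffs q d M = {c. (\<forall>k. k \<notin> freqs q d \<longrightarrow> c k = 0) \<and> card {k \<in> freqs q d. c k \<noteq> 0} \<le> M}"

text \<open>A run of Orthogonal Matching Pursuit for M iterations on input (F_X, y).
  Lam l = Lambda^l, cc l = c^l, kk l = the index selected in step l (any maximiser, ties arbitrary);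
  c^0 = 0 so that r^0 = y - F_X c^0 = y; c^{l+1} is any least-squares minimiser supported on Lambda^{l+1}.\<close>
definition omp_run :: "nat \<Rightarrow> nat \<Rightarrow> nat \<Rightarrow> nat \<Rightarrow> (nat \<Rightarrow> complex)
    \<Rightarrow> (nat \<Rightarrow> freq set) \<Rightarrow> (nat \<Rightarrow> freq) \<Rightarrow> (nat \<Rightarrow> freq \<Rightarrow> complex) \<Rightarrow> bool" where
  "omp_run q d N M y Lam kk cc \<longleftrightarrow>
     Lam 0 = {} \<and> cc 0 = (\<lambda>_. 0) \<and>
     (\<forall>l<M.
        (let r = (\<lambda>j. y j - FXmul q d N (cc l) j); h = FXadj d N r in
          kk l \<in> freqs q d \<and> (\<forall>k\<in>freqs q d. cmod (h k) \<le> cmod (h (kk l))) \<and>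
          Lam (Suc l) = insert (kk l) (Lam l) \<and>
          (\<forall>k. k \<notin> Lam (Suc l) \<longrightarrow> cc (Suc l) k = 0) \<and>
          (\<forall>z. (\<forall>k. k \<notin> Lam (Suc l) \<longrightarrow> z k = 0) \<longrightarrow>
               norm2 N (\<lambda>j. y j - FXmul q d N (cc (Suc l)) j)
                 \<le> norm2 N (\<lambda>j. y j - FXmul q d N z j))))"

definition bp_solution :: "nat \<Rightarrow> nat \<Rightarrow> nat \<Rightarrow> (nat \<Rightarrow> complex) \<Rightarrow> (freq \<Rightarrow> complex) \<Rightarrow> bool" where
  "bp_solution q d N y z \<longleftrightarrow>
     (\<forall>k. k \<notin> freqs q d \<longrightarrow> z k = 0) \<and> (\<forall>j\<in>{1..N}. FXmul q d N z j = y j) \<and>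
     (\<forall>w. (\<forall>k. k \<notin> freqs q d \<longrightarrow> w k = 0) \<and> (\<forall>j\<in>{1..N}. FXmul q d N w j = y j)
          \<longrightarrow> norm1 q d z \<le> norm1 q d w)"

end

theory Submission
  imports Defs
    "HOL-Algebra.Algebraic_Closure_Type"
    "HOL-Analysis.Kronecker_Approximation_Theorem"
    "HOL-Computational_Algebra.Fundamental_Theorem_Algebra"
    "HOL-Computational_Algebra.Polynomial_FPS"
    "Berlekamp_Zassenhaus.Finite_Field"
begin

text \<open>
  The Gram matrix of the columns consists of exponential sums of polynomials of degree at most \<open>d\<close>
  over the prime field, so Weil's bound gives coherence at most \<open>(d - 1) / sqrt N\<close>, which is less than
  \<open>1 / (2 M - 1)\<close>; below this threshold greedy and \<open>l\<^sup>1\<close> recovery are exact.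

  Weil's bound itself is obtained from the L-function: with \<open>S\<^sub>n\<close> the sum over the field with \<open>p\<^sup>n\<close>
  elements, \<open>exp (\<Sum> S\<^sub>n T\<^sup>n / n)\<close> is a polynomial of degree less than \<open>d\<close>, so \<open>S\<^sub>n = - (\<Sum> \<omega>\<^sub>i\<^sup>n)\<close> with fewer
  than \<open>d\<close> numbers \<open>\<omega>\<^sub>i\<close>. Stepanov's method bounds the number of points with prescribed trace, which
  yields \<open>S\<^sub>n = O(p\<^sup>n\<^sup>/\<^sup>2)\<close> for even \<open>n\<close>, and hence all \<open>\<omega>\<^sub>i\<close> have modulus at most \<open>sqrt p\<close>.
\<close>

\<comment> \<open>otherwise \<open>prime\<close> would denote the notion of HOL-Algebra, which has the same short name\<close>
hide_const (open) Divisibility.prime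

section \<open>Fields of prime characteristic\<close>

text \<open>All extension fields are fixed-point sets \<open>GF n\<close> of Frobenius iterates in
  one algebraically closed type, so roots are always at hand and polynomials over the prime field
  are handled through their root multisets. The L-function is a sum over monic \<open>g\<close> of
  the character of the sum of \<open>f\<close> over the roots of \<open>g\<close>. That sum depends
  only on the power sums of order at most \<open>degree f\<close>, and a suitable coefficient of
  \<open>g\<close> moves just the last of these; hence the coefficients from \<open>degree f\<close>
  on vanish. Stepanov's count gives upper bounds only, one for each trace value; as the counts add
  up to the size of the field, lower bounds come for free. The loss in its constant is harmless
  because the exponent \<open>n\<close> tends to infinity, and even \<open>n\<close> suffice to
  detect the moduli of the \<omega>.\<close>

instance alg_closure :: (field_prime_char) field_prime_char
  by standard simp

lemma add_power_CHAR:
  fixes x y :: "'a :: {comm_ring_1, comm_semiring_prime_char}"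
  shows "(x + y) ^ (CHAR('a) ^ n) = x ^ (CHAR('a) ^ n) + y ^ (CHAR('a) ^ n)"
  by (rule freshmans_dream'[where n = n]) auto

lemma sum_power_CHAR:
  fixes f :: "'b \<Rightarrow> 'a :: {comm_ring_1, comm_semiring_prime_char}"
  shows "(\<Sum>i\<in>A. f i) ^ (CHAR('a) ^ n) = (\<Sum>i\<in>A. f i ^ (CHAR('a) ^ n))"
  by (rule freshmans_dream_sum'[where n = n]) auto

text \<open>Membership is an equation, so all extension fields share one type. For
  \<open>n = 0\<close> the set is the whole type, hence the recurring \<open>n > 0\<close>.\<close>

definition GF :: "nat \<Rightarrow> 'a :: field_prime_char set" where
  "GF n = {x. x ^ (CHAR('a) ^ n) = x}"

lemma diff_power_CHAR:
  fixes x y :: "'a :: field_prime_char"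
  shows "(x - y) ^ (CHAR('a) ^ n) = x ^ (CHAR('a) ^ n) - y ^ (CHAR('a) ^ n)"
  using add_power_CHAR[of "x - y" y n] by (simp add: algebra_simps)

lemma GF_0 [simp]: "0 \<in> GF n" and GF_1 [simp]: "1 \<in> GF n"
  by (auto simp: GF_def)

lemma GF_add: "x \<in> GF n \<Longrightarrow> y \<in> GF n \<Longrightarrow> x + y \<in> GF n"
  by (simp add: GF_def add_power_CHAR)

lemma GF_diff: "x \<in> GF n \<Longrightarrow> y \<in> GF n \<Longrightarrow> x - y \<in> GF n"
  by (simp add: GF_def diff_power_CHAR)

lemma GF_uminus: "x \<in> GF n \<Longrightarrow> - x \<in> GF n"
  using GF_diff[of 0 n x] by simp

lemma GF_mult: "x \<in> GF n \<Longrightarrow> y \<in> GF n \<Longrightarrow> x * y \<in> GF n"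
  by (simp add: GF_def power_mult_distrib)

lemma GF_sum: "(\<And>i. i \<in> A \<Longrightarrow> f i \<in> GF n) \<Longrightarrow> (\<Sum>i\<in>A. f i) \<in> GF n"
  by (induction A rule: infinite_finite_induct) (auto intro: GF_add)

lemma GF_of_nat [simp]: "of_nat k \<in> GF n"
  by (induction k) (auto intro: GF_add)

lemma GF_of_int [simp]: "of_int k \<in> GF n"
  by (cases k rule: int_cases2) (auto intro: GF_uminus)

lemma inj_power_CHAR: "x ^ (CHAR('a) ^ n) = y ^ (CHAR('a) ^ n) \<Longrightarrow> x = (y :: 'a :: field_prime_char)"
  using diff_power_CHAR[of x y n] by simp

lemma degree_frobenius_poly:
  assumes "n > 0"
  shows "degree (monom 1 (CHAR('a) ^ n) - monom 1 1 :: 'a :: field_prime_char poly) = CHAR('a) ^ n"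
proof -
  have "CHAR('a) ^ n > 1"
    using assms by (metis CHAR_prime one_less_power prime_gt_1_nat)
  then show ?thesis
    using degree_add_eq_left[of "- monom 1 1" "monom 1 (CHAR('a) ^ n) :: 'a poly"]
    by (simp add: degree_monom_eq)
qed

lemma GF_eq_roots:
  "GF n = {x :: 'a :: field_prime_char. poly (monom 1 (CHAR('a) ^ n) - monom 1 1) x = 0}"
  by (auto simp: GF_def poly_monom)

lemma finite_GF [simp]:
  assumes "n > 0"
  shows "finite (GF n :: 'a :: field_prime_char set)"
proof -
  have "(monom 1 (CHAR('a) ^ n) - monom 1 1 :: 'a poly) \<noteq> 0"
    using degree_frobenius_poly[OF assms, where 'a = 'a] by (metis CHAR_nonzero degree_0 power_not_zero)
  then show ?thesis
    unfolding GF_eq_roots by (rule poly_roots_finite)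
qed

lemma proots_prod_linear [simp]: "proots (\<Prod>x\<in>#A. [:-x, 1:]) = A"
proof (induction A)
  case (add x A)
  have "(\<Prod>x\<in>#A. [:-x, 1:]) \<noteq> 0" by (auto simp: prod_mset_zero_iff)
  then show ?case using add by (simp add: proots_mult del: mult_pCons_left)
qed auto

lemma size_proots_alg_closed:
  fixes g :: "'a :: alg_closed_field poly"
  shows "size (proots g) = degree g"
proof (cases "g = 0")
  case False
  obtain A where A: "size A = degree g" "g = smult (lead_coeff g) (\<Prod>x\<in>#A. [:-x, 1:])"
    using alg_closed_imp_factorization[OF False] by blast
  have "proots g = proots (\<Prod>x\<in>#A. [:-x, 1:])"
    by (subst A(2)) (use False in simp)
  also have "\<dots> = A" by simp
  finally show ?thesis using A(1) by simp
qed auto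

lemma alg_closed_eq_prod_roots:
  fixes g :: "'a :: alg_closed_field poly"
  assumes "lead_coeff g = 1"
  shows "g = (\<Prod>x\<in>#proots g. [:-x, 1:])"
proof -
  have "g \<noteq> 0" using assms by auto
  obtain A where A: "size A = degree g" "g = smult (lead_coeff g) (\<Prod>x\<in>#A. [:-x, 1:])"
    using alg_closed_imp_factorization[OF \<open>g \<noteq> 0\<close>] by blast
  have "proots g = A"
    by (subst A(2)) (simp add: assms)
  then show ?thesis using A assms by simp
qed

lemma dvd_iff_proots_subset:
  fixes g h :: "'a :: alg_closed_field poly"
  assumes "lead_coeff g = 1" "lead_coeff h = 1"
  shows "g dvd h \<longleftrightarrow> proots g \<subseteq># proots h"
proof
  assume "g dvd h"
  then obtain k where k: "h = g * k" by (elim dvdE)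
  with assms have "g * k \<noteq> 0" by auto
  then show "proots g \<subseteq># proots h" by (simp add: k proots_mult)
next
  assume "proots g \<subseteq># proots h"
  then show "g dvd h"
    by (subst alg_closed_eq_prod_roots[OF assms(1)], subst alg_closed_eq_prod_roots[OF assms(2)])
       (intro prod_mset_subset_imp_dvd image_mset_subseteq_mono)
qed

text \<open>\<open>X^(p^n) - X\<close> splits over the closed field and has derivative
  \<open>-1\<close> in characteristic \<open>p\<close>, so its \<open>p^n\<close> roots are
  simple.\<close>

lemma card_GF:
  assumes "n > 0"
  shows "card (GF n :: 'a :: {alg_closed_field, field_prime_char} set) = CHAR('a) ^ n"
proof -
  let ?P = "monom 1 (CHAR('a) ^ n) - monom 1 1 :: 'a poly"
  have deg: "degree ?P = CHAR('a) ^ n" by (rule degree_frobenius_poly[OF assms])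
  have nz: "?P \<noteq> 0" using deg by (metis CHAR_nonzero degree_0 power_not_zero)
  have "order x ?P \<le> 1" for x
  proof (rule ccontr)
    assume "\<not> order x ?P \<le> 1"
    then have "[:-x, 1:] ^ 2 dvd ?P" using nz by (simp add: order_divides)
    then obtain k where k: "?P = [:-x, 1:] ^ 2 * k" by (elim dvdE)
    have "poly (pderiv ?P) x = 0"
      unfolding k by (simp add: pderiv_mult power2_eq_square pderiv_pCons del: mult_pCons_left mult_pCons_right)
    moreover have "pderiv ?P = -1"
      using assms by (simp add: pderiv_diff pderiv_monom of_nat_power)
    ultimately show False by simp
  qed
  then have "count (proots ?P) x \<le> 1" for x using nz by simp
  then have "proots ?P = mset_set (set_mset (proots ?P))"
    by (intro multiset_eqI) (metis (no_types, opaque_lifting) One_nat_def count_greater_zero_iff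
        count_mset_set(1) count_mset_set(3) finite_set_mset le_antisym Suc_leI not_in_iff)
  then have "size (proots ?P) = card (set_mset (proots ?P))"
    by (metis size_mset_set)
  then show ?thesis
    using nz deg by (simp add: size_proots_alg_closed GF_eq_roots)
qed

lemma GF_1_eq: "(GF 1 :: 'a :: {alg_closed_field, field_prime_char} set) = of_nat ` {..<CHAR('a)}"
proof -
  have "inj_on (of_nat :: nat \<Rightarrow> 'a) {..<CHAR('a)}"
    by (intro inj_onI) (auto simp: of_nat_eq_iff_cong_CHAR cong_def)
  then have "card (of_nat ` {..<CHAR('a)} :: 'a set) = CHAR('a)"
    by (simp add: card_image)
  then show ?thesis
    by (intro sym[OF card_subset_eq]) (auto simp: card_GF)
qed

section \<open>The additive character of the prime field\<close>

lemma cis_int_cong: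
  assumes "[a = b] (mod int p)" "p > 0"
  shows "cis (2 * pi * real_of_int a / real p) = cis (2 * pi * real_of_int b / real p)"
proof -
  obtain t where "b = a + int p * t" using assms(1) cong_iff_lin by blast
  then have "2 * pi * real_of_int b / real p = 2 * pi * real_of_int a / real p + 2 * pi * real_of_int t"
    using assms(2) by (simp add: field_simps)
  then show ?thesis
    by (simp add: cis_mult[symmetric] cis_multiple_2pi)
qed

text \<open>The character \<open>x -> exp (2 pi i x / p)\<close>. The choice of representative is
  irrelevant by periodicity; off the prime field the value is arbitrary but still of modulus
  1.\<close>

definition add_char :: "'a :: field_prime_char \<Rightarrow> complex" where
  "add_char x = cis (2 * pi * real (SOME k. of_nat k = x) / real CHAR('a))"

lemma add_char_of_nat:
  "add_char (of_nat k :: 'a :: field_prime_char) = cis (2 * pi * real k / real CHAR('a))"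
proof -
  have "of_nat (SOME j. of_nat j = (of_nat k :: 'a)) = (of_nat k :: 'a)"
    by (rule someI) simp
  then show ?thesis
    unfolding add_char_def using cis_int_cong[of "int (SOME j. of_nat j = (of_nat k :: 'a))" "int k" "CHAR('a)"]
    by (simp add: of_nat_eq_iff_cong_CHAR cong_int_iff)
qed

lemma norm_add_char [simp]: "cmod (add_char x) = 1"
  by (simp add: add_char_def)

lemma add_char_add:
  fixes x y :: "'a :: {alg_closed_field, field_prime_char}"
  assumes "x \<in> GF 1" "y \<in> GF 1"
  shows "add_char (x + y) = add_char x * add_char y"
proof -
  obtain a b where "x = of_nat a" "y = of_nat b" using assms unfolding GF_1_eq by auto
  then have "add_char (x + y) = add_char (of_nat (a + b) :: 'a)" by simp
  also have "\<dots> = add_char x * add_char y"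
    unfolding add_char_of_nat \<open>x = _\<close> \<open>y = _\<close> by (simp add: cis_mult add_divide_distrib algebra_simps)
  finally show ?thesis .
qed

lemma add_char_0 [simp]: "add_char 0 = 1"
  using add_char_of_nat[of 0] by simp

lemma add_char_neq_1:
  fixes x :: "'a :: {alg_closed_field, field_prime_char}"
  assumes "x \<in> GF 1" "x \<noteq> 0"
  shows "add_char x \<noteq> 1"
proof -
  obtain k where k: "x = of_nat k" "k < CHAR('a)" using assms unfolding GF_1_eq by auto
  with assms have "k > 0" by (cases k) auto
  define p where "p = real CHAR('a)"
  have "p > 0" by (simp add: p_def)
  have "cis (2 * pi * real k / p) \<noteq> 1"
  proof
    assume "cis (2 * pi * real k / p) = 1"
    then have "cos (2 * pi * real k / p) = 1" by (simp add: complex_eq_iff)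
    then obtain n :: int where "2 * pi * real k / p = of_int n * 2 * pi" using cos_one_2pi_int by auto
    then have "(2 * pi) * (real k / p) = (2 * pi) * of_int n" by (simp add: mult_ac)
    then have "real k / p = of_int n" by (subst (asm) mult_cancel_left) simp
    moreover have "0 < real k / p" "real k / p < 1" using k \<open>k > 0\<close> \<open>p > 0\<close> by (auto simp: p_def)
    ultimately show False by auto
  qed
  then show ?thesis by (simp add: k(1) add_char_of_nat p_def)
qed

section \<open>Power sums of the roots of a polynomial\<close>

text \<open>Coefficient form of \<open>X P' = - S P\<close>, the logarithmic derivative of
  \<open>P\<close>: each root adds the series of \<open>a X / (1 - a X)\<close> to \<open>S\<close>.
  The factor \<open>n\<close> stays on the left because the identity serves characteristic
  \<open>p\<close> as well as the complex numbers.\<close>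

lemma newton_identity:
  fixes A :: "'a :: idom multiset"
  defines "P \<equiv> \<Prod>a\<in>#A. [:1, -a:]"
  shows "of_nat n * coeff P n = - (\<Sum>m=1..n. (\<Sum>a\<in>#A. a ^ m) * coeff P (n - m))"
proof -
  define S where "S = (\<lambda>A :: 'a multiset. Abs_fps (\<lambda>m. if m = 0 then 0 else \<Sum>a\<in>#A. a ^ m))"
  define R where "R = (\<lambda>A :: 'a multiset. fps_of_poly (\<Prod>a\<in>#A. [:1, -a:]))"
  have "fps_X * fps_deriv (R A) = - S A * R A"
  proof (induction A)
    case empty
    have "S {#} = 0" by (simp add: S_def fps_eq_iff)
    then show ?case by (simp add: R_def)
  next
    case (add a A)
    define L where "L = 1 - fps_const a * fps_X"
    have L: "fps_of_poly [:1, -a:] = L"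
      by (simp add: L_def fps_of_poly_pCons mult.commute)
    have R: "R (add_mset a A) = L * R A"
      unfolding R_def by (simp only: image_mset_add_mset prod_mset.add_mset fps_of_poly_mult L)
    have "S {#a#} * L = S {#a#} - fps_X * (fps_const a * S {#a#})"
      by (simp add: L_def algebra_simps)
    also have "\<dots> = fps_const a * fps_X"
    proof (rule fps_ext)
      fix n show "(S {#a#} - fps_X * (fps_const a * S {#a#})) $ n = (fps_const a * fps_X) $ n"
        by (cases n) (auto simp: S_def fps_X_mult_nth fps_X_nth)
    qed
    finally have "S {#a#} * L = fps_const a * fps_X" .
    moreover have "S (add_mset a A) = S {#a#} + S A"
      by (auto simp: S_def fps_eq_iff)
    moreover have "fps_deriv L = - fps_const a"
      by (simp add: L_def)
    ultimately have S: "S {#a#} * L = fps_const a * fps_X" "S (add_mset a A) = S {#a#} + S A"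
      "fps_deriv L = - fps_const a" by blast+
    have "fps_X * fps_deriv (L * R A) = L * (fps_X * fps_deriv (R A)) - (fps_const a * fps_X) * R A"
      by (simp add: S(3) algebra_simps del: fps_const_neg)
    also have "\<dots> = L * (- S A * R A) - (S {#a#} * L) * R A"
      by (simp only: add.IH S(1))
    also have "\<dots> = - (S {#a#} + S A) * (L * R A)"
      by (simp add: algebra_simps)
    finally show ?case
      unfolding R S(2) .
  qed
  then have "(fps_X * fps_deriv (R A)) $ n = (- S A * R A) $ n" by simp
  moreover have "(fps_X * fps_deriv (R A)) $ n = of_nat n * coeff P n"
    by (cases n) (auto simp: R_def P_def)
  moreover have "(- S A * R A) $ n = - (\<Sum>m=0..n. S A $ m * R A $ (n - m))"
    by (simp add: fps_mult_nth)
  moreover have "(\<Sum>m=0..n. S A $ m * R A $ (n - m)) = (\<Sum>m=1..n. S A $ m * R A $ (n - m))"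
    by (rule sum.mono_neutral_right) (auto simp: S_def)
  moreover have "\<dots> = (\<Sum>m=1..n. (\<Sum>a\<in>#A. a ^ m) * coeff P (n - m))"
    by (rule sum.cong) (auto simp: S_def R_def P_def)
  ultimately show ?thesis by simp
qed

definition power_sum :: "'a :: idom poly \<Rightarrow> nat \<Rightarrow> 'a" where
  "power_sum g m = (\<Sum>x\<in>#proots g. x ^ m)"

lemma reflect_poly_prod_linear:
  "reflect_poly (\<Prod>x\<in>#A. [:-x, 1 :: 'a :: idom:]) = (\<Prod>x\<in>#A. [:1, -x:])"
proof (induction A)
  case (add x A)
  have "reflect_poly [:-x, 1:] = [:1, -x:]"
    by (cases "x = 0") (simp_all add: reflect_poly_def)
  then show ?case using add by (simp add: reflect_poly_mult del: mult_pCons_left)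
qed auto

lemma power_sum_newton:
  fixes g :: "'a :: alg_closed_field poly"
  assumes "lead_coeff g = 1"
  shows "of_nat n * coeff (reflect_poly g) n
           = - (\<Sum>m=1..n. power_sum g m * coeff (reflect_poly g) (n - m))"
  using newton_identity[of n "proots g"] reflect_poly_prod_linear[of "proots g"]
    alg_closed_eq_prod_roots[OF assms]
  by (simp add: power_sum_def)

lemma power_sum_rec:
  fixes g :: "'a :: alg_closed_field poly"
  assumes "lead_coeff g = 1" "n > 0"
  shows "power_sum g n = - of_nat n * coeff (reflect_poly g) n
           - (\<Sum>m=1..<n. power_sum g m * coeff (reflect_poly g) (n - m))"
proof -
  have "{1..n} = insert n {1..<n}" using assms by auto
  then show ?thesis using power_sum_newton[OF assms(1), of n] assms by simp
qed

lemma power_sum_0: "power_sum g 0 = of_nat (size (proots g))"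
  by (simp add: power_sum_def)

lemma sum_roots_eq_power_sums:
  "(\<Sum>x\<in>#proots g. poly f x) = (\<Sum>k\<le>degree f. coeff f k * power_sum g k)"
proof -
  have "(\<Sum>x\<in>#A. poly f x) = (\<Sum>k\<le>degree f. coeff f k * (\<Sum>x\<in>#A. x ^ k))" for A
    by (induction A) (auto simp: poly_altdef sum.distrib distrib_left)
  then show ?thesis by (simp add: power_sum_def)
qed

section \<open>The L-function of an additive character sum\<close>

text \<open>Polynomials over the prime field, kept in the type over the ambient field so that their
  roots are available.\<close>

definition monic_polys :: "nat \<Rightarrow> 'a :: field_prime_char poly set" where
  "monic_polys r = {g. degree g = r \<and> lead_coeff g = 1 \<and> (\<forall>i. coeff g i \<in> GF 1)}"

lemma finite_monic_polys: "finite (monic_polys r :: 'a :: field_prime_char poly set)"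
proof -
  let ?f = "\<lambda>g :: 'a poly. map (coeff g) [0..<Suc r]"
  have "inj_on ?f (monic_polys r)"
  proof (rule inj_onI, rule poly_eqI)
    fix g h :: "'a poly" and i
    assume gh: "g \<in> monic_polys r" "h \<in> monic_polys r" "?f g = ?f h"
    show "coeff g i = coeff h i"
    proof (cases "i < Suc r")
      case True
      have "?f g ! i = ?f h ! i" by (simp only: gh(3))
      then show ?thesis using True by (simp del: upt_Suc)
    qed (use gh in \<open>auto simp: monic_polys_def coeff_eq_0\<close>)
  qed
  moreover have "?f ` monic_polys r \<subseteq> {xs. set xs \<subseteq> GF 1 \<and> length xs = Suc r}"
    by (auto simp: monic_polys_def simp del: upt_Suc)
  moreover have "finite {xs. set xs \<subseteq> (GF 1 :: 'a set) \<and> length xs = Suc r}"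
    by (rule finite_lists_length_eq) simp
  ultimately show ?thesis
    using finite_subset finite_imageD by blast
qed

lemma power_sum_in_GF:
  fixes g :: "'a :: {alg_closed_field, field_prime_char} poly"
  assumes "g \<in> monic_polys r"
  shows "power_sum g n \<in> GF 1"
proof (induction n rule: less_induct)
  case (less n)
  show ?case
  proof (cases "n = 0")
    case False
    have "coeff (reflect_poly g) i \<in> GF 1" for i
      using assms by (auto simp: coeff_reflect_poly monic_polys_def)
    then show ?thesis
      using False assms less
      by (subst power_sum_rec) (auto simp: monic_polys_def intro!: GF_diff GF_mult GF_sum GF_uminus)
  qed (simp add: power_sum_0)
qed

text \<open>The added monomial is coefficient \<open>d\<close> of the reflected polynomial; the
  lower ones are untouched. By Newton's recursion the power sums below order \<open>d\<close>
  persist and the one of order \<open>d\<close> changes by \<open>- d t\<close>.\<close>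

lemma power_sum_shift:
  fixes g :: "'a :: alg_closed_field poly" and t :: 'a
  assumes g: "lead_coeff g = 1" and d: "0 < d" "d \<le> degree g" and n: "n \<le> d"
  defines "g' \<equiv> g + monom t (degree g - d)"
  shows "degree g' = degree g" "lead_coeff g' = 1"
    "power_sum g' n = power_sum g n - (if n = d then of_nat d * t else 0)"
proof -
  have "degree (monom t (degree g - d)) < degree g"
    using d degree_monom_le[of t "degree g - d"] by linarith
  then show deg: "degree g' = degree g" by (simp add: g'_def degree_add_eq_left)
  then show lead: "lead_coeff g' = 1" using g d by (simp add: g'_def)
  have refl: "coeff (reflect_poly g') m = coeff (reflect_poly g) m + (if m = d then t else 0)" if "m \<le> d" for m
    using that d deg by (auto simp: coeff_reflect_poly g'_def)
  show "power_sum g' n = power_sum g n - (if n = d then of_nat d * t else 0)"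
    using n
  proof (induction n rule: less_induct)
    case (less n)
    show ?case
    proof (cases "n = 0")
      case False
      have "(\<Sum>m=1..<n. power_sum g' m * coeff (reflect_poly g') (n - m))
          = (\<Sum>m=1..<n. power_sum g m * coeff (reflect_poly g) (n - m))"
        using less by (intro sum.cong) (auto simp: refl)
      then show ?thesis
        using False less.prems g lead by (auto simp: power_sum_rec refl algebra_simps)
    qed (use d in \<open>simp add: power_sum_0 size_proots_alg_closed deg\<close>)
  qed
qed

section \<open>Frobenius acting on the coefficients of polynomials\<close>

definition frob_poly :: "'a :: field_prime_char poly \<Rightarrow> 'a poly" where
  "frob_poly g = map_poly (\<lambda>x. x ^ CHAR('a)) g"

lemma coeff_frob_poly [simp]:
  "coeff (frob_poly g) i = coeff (g :: 'a :: field_prime_char poly) i ^ CHAR('a)"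
  by (simp add: frob_poly_def coeff_map_poly power_0_left)

lemma frob_poly_mult: "frob_poly (g * h) = frob_poly g * frob_poly h"
proof (rule poly_eqI)
  fix n
  show "coeff (frob_poly (g * h)) n = coeff (frob_poly g * frob_poly h) n"
    using sum_power_CHAR[of "\<lambda>i. coeff g i * coeff h (n - i)" "{..n}" 1]
    by (simp add: coeff_mult power_mult_distrib)
qed

lemma frob_poly_1 [simp]: "frob_poly 1 = 1"
  by (rule poly_eqI) (simp add: power_0_left)

lemma frob_poly_power: "frob_poly (g ^ n) = frob_poly g ^ n"
  by (induction n) (auto simp: frob_poly_mult)

lemma uminus_power_CHAR: "(- x) ^ CHAR('a) = - (x ^ CHAR('a))" for x :: "'a :: field_prime_char"
  using diff_power_CHAR[of 0 x 1] by (simp add: power_0_left)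

lemma frob_poly_linear [simp]:
  "frob_poly [:-x, 1:] = [:- (x ^ CHAR('a)), 1 :: 'a :: field_prime_char:]"
  by (rule poly_eqI) (auto simp: coeff_pCons uminus_power_CHAR power_0_left split: nat.splits)

lemma frob_poly_prod_linear:
  "frob_poly (\<Prod>x\<in>#A. [:-x, 1:]) = (\<Prod>x\<in>#A. [:- (x ^ CHAR('a)), 1 :: 'a :: field_prime_char:])"
  by (induction A) (auto simp: frob_poly_mult simp del: mult_pCons_left)

text \<open>With multiplicativity this turns rationality of products, cofactors and characteristic
  polynomials into an equation between polynomials.\<close>

lemma frob_poly_eq_iff:
  "frob_poly g = g \<longleftrightarrow> (\<forall>i. coeff (g :: 'a :: field_prime_char poly) i \<in> GF 1)"
  by (auto simp: poly_eq_iff GF_def)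

lemma poly_power_CHAR:
  fixes g :: "'a :: field_prime_char poly"
  assumes "\<forall>i. coeff g i \<in> GF 1"
  shows "poly g (x ^ (CHAR('a) ^ n)) = poly g x ^ (CHAR('a) ^ n)"
proof -
  have 1: "poly g (x ^ CHAR('a)) = poly g x ^ CHAR('a)" for x
    using sum_power_CHAR[of "\<lambda>i. coeff g i * x ^ i" "{..degree g}" 1] assms
    by (simp add: poly_altdef power_mult_distrib GF_def mult.commute flip: power_mult)
  show ?thesis
  proof (induction n)
    case (Suc n)
    have "poly g (x ^ (CHAR('a) ^ Suc n)) = poly g ((x ^ (CHAR('a) ^ n)) ^ CHAR('a))"
      by (simp add: mult.commute flip: power_mult)
    also have "\<dots> = (poly g x ^ (CHAR('a) ^ n)) ^ CHAR('a)"
      by (simp only: 1 Suc.IH)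
    finally show ?case by (simp add: mult.commute flip: power_mult)
  qed simp
qed

text \<open>Applying \<open>frob_poly\<close> to \<open>g = (X - x)^m k\<close> fixes
  \<open>g\<close> and turns the linear factor into \<open>X - x^p\<close>.\<close>

lemma order_le_order_power_CHAR:
  fixes g :: "'a :: field_prime_char poly"
  assumes "\<forall>i. coeff g i \<in> GF 1" "g \<noteq> 0"
  shows "order x g \<le> order (x ^ (CHAR('a) ^ n)) g"
proof -
  have 1: "order x g \<le> order (x ^ CHAR('a)) g" for x
  proof -
    obtain k where k: "g = [:-x, 1:] ^ order x g * k" using order_1[of x g] by (elim dvdE)
    have "frob_poly g = [:- (x ^ CHAR('a)), 1:] ^ order x g * frob_poly k"
      by (subst k) (simp add: frob_poly_mult frob_poly_power)
    moreover have "frob_poly g = g" using assms(1) by (rule frob_poly_eq_iff[THEN iffD2])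
    ultimately have "[:- (x ^ CHAR('a)), 1:] ^ order x g dvd g" by (metis dvd_triv_left)
    then show ?thesis using assms(2) by (simp add: order_divides)
  qed
  show ?thesis
  proof (induction n)
    case (Suc n)
    have "order x g \<le> order ((x ^ (CHAR('a) ^ n)) ^ CHAR('a)) g"
      using 1 Suc.IH order_trans by blast
    then show ?case by (simp add: mult.commute flip: power_mult)
  qed simp
qed

lemma order_conjugate:
  fixes g :: "'a :: field_prime_char poly"
  assumes "\<forall>i. coeff g i \<in> GF 1" "g \<noteq> 0" "x \<in> GF e" "i \<le> e"
  shows "order (x ^ (CHAR('a) ^ i)) g = order x g"
proof (rule antisym)
  have "(x ^ (CHAR('a) ^ i)) ^ (CHAR('a) ^ (e - i)) = x"
    using assms by (simp add: GF_def flip: power_mult power_add)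
  then show "order (x ^ (CHAR('a) ^ i)) g \<le> order x g"
    using order_le_order_power_CHAR[OF assms(1,2), of "x ^ (CHAR('a) ^ i)" "e - i"] by simp
qed (rule order_le_order_power_CHAR[OF assms(1,2)])

section \<open>Conjugates and characteristic polynomials of field elements\<close>

definition conjugates :: "nat \<Rightarrow> 'a :: field_prime_char \<Rightarrow> 'a multiset" where
  "conjugates n x = image_mset (\<lambda>i. x ^ (CHAR('a) ^ i)) (mset_set {..<n})"

text \<open>For \<open>x\<close> in \<open>GF n\<close>, \<open>n > 0\<close>, the characteristic
  polynomial of multiplication by \<open>x\<close>: a power of the minimal polynomial, which is why
  \<open>conjugates\<close> is a multiset.\<close>

definition charpoly :: "nat \<Rightarrow> 'a :: field_prime_char \<Rightarrow> 'a poly" where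
  "charpoly n x = (\<Prod>y\<in>#conjugates n x. [:-y, 1:])"

lemma proots_charpoly [simp]: "proots (charpoly n x) = conjugates n x"
  by (simp add: charpoly_def)

lemma lead_coeff_prod_linear: "lead_coeff (\<Prod>y\<in>#A. [:-y, 1 :: 'a :: idom:]) = 1"
  by (induction A) (auto simp: lead_coeff_mult simp del: mult_pCons_left)

lemma degree_charpoly: "degree (charpoly n x :: 'a :: {alg_closed_field, field_prime_char} poly) = n"
  by (simp flip: size_proots_alg_closed) (simp add: conjugates_def)

lemma conjugates_frobenius:
  fixes x :: "'a :: field_prime_char"
  assumes "x \<in> GF n"
  shows "image_mset (\<lambda>y. y ^ CHAR('a)) (conjugates n x) = conjugates n x"
proof (cases "n = 0")
  case False
  let ?h = "\<lambda>i. x ^ (CHAR('a) ^ i)"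
  have "image_mset (\<lambda>y. y ^ CHAR('a)) (conjugates n x) = image_mset ?h (image_mset Suc (mset_set {..<n}))"
    by (simp add: conjugates_def multiset.map_comp o_def mult.commute flip: power_mult)
  also have "image_mset Suc (mset_set {..<n}) = mset_set (insert n {1..<n})"
  proof -
    have "Suc ` {..<n} = insert n {1..<n}"
      using False by (auto simp: lessThan_atLeast0)
    then show ?thesis by (subst image_mset_mset_set) auto
  qed
  also have "image_mset ?h \<dots> = add_mset (?h n) (image_mset ?h (mset_set {1..<n}))"
    by simp
  also have "?h n = ?h 0" using assms by (simp add: GF_def)
  also have "add_mset (?h 0) (image_mset ?h (mset_set {1..<n})) = image_mset ?h (mset_set (insert 0 {1..<n}))"
    by simp
  also have "insert 0 {1..<n} = {..<n}" using False by auto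
  finally show ?thesis by (simp add: conjugates_def)
qed (simp add: conjugates_def)

lemma charpoly_in_monic_polys:
  fixes x :: "'a :: {alg_closed_field, field_prime_char}"
  assumes "x \<in> GF n"
  shows "charpoly n x \<in> monic_polys n"
proof -
  have "frob_poly (charpoly n x) = (\<Prod>y\<in>#image_mset (\<lambda>y. y ^ CHAR('a)) (conjugates n x). [:-y, 1:])"
    by (simp add: charpoly_def frob_poly_prod_linear multiset.map_comp o_def)
  then have "frob_poly (charpoly n x) = charpoly n x"
    using conjugates_frobenius[OF assms] by (simp add: charpoly_def)
  then show ?thesis
    using lead_coeff_prod_linear[of "conjugates n x"]
    unfolding monic_polys_def frob_poly_eq_iff charpoly_def[symmetric] by (simp add: degree_charpoly)
qed

text \<open>Frobenius maps the finite root set into itself, so two iterates of \<open>x\<close>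
  coincide; injectivity cancels the smaller exponent.\<close>

lemma root_in_GF:
  fixes g :: "'a :: field_prime_char poly"
  assumes "\<forall>i. coeff g i \<in> GF 1" "g \<noteq> 0" "poly g x = 0"
  obtains e where "e > 0" "x \<in> GF e"
proof -
  let ?h = "\<lambda>i. x ^ (CHAR('a) ^ i)"
  have "range ?h \<subseteq> {y. poly g y = 0}"
    using assms by (auto simp: poly_power_CHAR power_0_left)
  then have "finite (range ?h)" using poly_roots_finite[OF assms(2)] finite_subset by blast
  then have "\<not> inj ?h" using finite_imageD by blast
  then obtain i j where "?h i = ?h j" "i < j"
    by (metis (mono_tags, lifting) linorder_injI)
  then have "(x ^ (CHAR('a) ^ (j - i))) ^ (CHAR('a) ^ i) = x ^ (CHAR('a) ^ i)"
    by (simp flip: power_mult power_add)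
  then have "x ^ (CHAR('a) ^ (j - i)) = x" by (rule inj_power_CHAR)
  then show ?thesis using \<open>i < j\<close> by (intro that[of "j - i"]) (auto simp: GF_def)
qed

lemma power_CHAR_mult_period:
  fixes x :: "'a :: field_prime_char"
  assumes "x \<in> GF e"
  shows "x ^ (CHAR('a) ^ (e * k + j)) = x ^ (CHAR('a) ^ j)"
proof (induction k)
  case (Suc k)
  have "x ^ (CHAR('a) ^ (e * Suc k + j)) = (x ^ (CHAR('a) ^ e)) ^ (CHAR('a) ^ (e * k + j))"
    by (simp add: add_ac flip: power_mult power_add)
  then show ?case using assms Suc by (simp add: GF_def)
qed simp

lemma in_GF_iff_dvd_period:
  fixes x :: "'a :: field_prime_char"
  assumes "x \<in> GF e" "e > 0" "\<And>j. 0 < j \<Longrightarrow> j < e \<Longrightarrow> x \<notin> GF j"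
  shows "x \<in> GF n \<longleftrightarrow> e dvd n"
proof -
  have "x ^ (CHAR('a) ^ n) = x ^ (CHAR('a) ^ (n mod e))"
    using power_CHAR_mult_period[OF assms(1), of "n div e" "n mod e"] by simp
  then have "x \<in> GF n \<longleftrightarrow> x \<in> GF (n mod e)" by (simp add: GF_def)
  also have "\<dots> \<longleftrightarrow> n mod e = 0"
    using assms(2) assms(3)[of "n mod e"] by (cases "n mod e = 0") (auto simp: GF_def)
  finally show ?thesis by auto
qed

lemma conjugates_mult_period:
  assumes "x \<in> GF e"
  shows "conjugates (e * k) x = repeat_mset k (conjugates e x)"
proof (induction k)
  case (Suc k)
  let ?h = "\<lambda>i. x ^ (CHAR('a) ^ i)"
  have "{..<e * Suc k} = {..<e * k} \<union> (\<lambda>i. e * k + i) ` {..<e}"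
  proof (intro equalityI subsetI)
    fix i assume "i \<in> {..<e * Suc k}"
    then show "i \<in> {..<e * k} \<union> (\<lambda>i. e * k + i) ` {..<e}"
      by (cases "i < e * k") (auto intro!: image_eqI[of _ _ "i - e * k"])
  qed auto
  then have "mset_set {..<e * Suc k} = mset_set {..<e * k} + mset_set ((\<lambda>i. e * k + i) ` {..<e})"
    by (simp only:) (rule mset_set_Union, auto)
  also have "mset_set ((\<lambda>i. e * k + i) ` {..<e}) = image_mset (\<lambda>i. e * k + i) (mset_set {..<e})"
    by (rule image_mset_mset_set[symmetric]) auto
  finally show ?case
    using Suc by (simp add: conjugates_def multiset.map_comp o_def power_CHAR_mult_period[OF assms])
qed (simp add: conjugates_def)

text \<open>If \<open>e\<close> is the degree of \<open>x\<close>, the admissible \<open>n\<close>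
  are multiples \<open>e * k\<close>, and \<open>charpoly (e * k) x\<close> is the
  \<open>k\<close>-th power of the minimal polynomial, dividing \<open>G\<close> exactly for
  \<open>k \<le> order x G\<close>.\<close>

lemma card_charpoly_divisors:
  fixes G :: "'a :: {alg_closed_field, field_prime_char} poly"
  assumes "G \<in> monic_polys r" "poly G x = 0"
  shows "card {n \<in> {1..r}. x \<in> GF n \<and> charpoly n x dvd G} = order x G"
proof -
  have G: "degree G = r" "lead_coeff G = 1" "\<forall>i. coeff G i \<in> GF 1" "G \<noteq> 0"
    using assms by (auto simp: monic_polys_def)
  define e where "e = (LEAST e. e > 0 \<and> x \<in> GF e)"
  have "\<exists>e. e > 0 \<and> x \<in> GF e" using root_in_GF[OF G(3,4) assms(2)] by blast
  from LeastI_ex[OF this] have e: "e > 0" "x \<in> GF e" unfolding e_def by auto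
  have min: "x \<notin> GF j" if "0 < j" "j < e" for j
    using not_less_Least[of j "\<lambda>e. e > 0 \<and> x \<in> GF e"] that unfolding e_def by auto
  have inj: "inj_on (\<lambda>i. x ^ (CHAR('a) ^ i)) {..<e}"
  proof (rule linorder_inj_onI)
    fix i j assume ij: "i < j" "i \<in> {..<e}" "j \<in> {..<e}"
    show "x ^ (CHAR('a) ^ i) \<noteq> x ^ (CHAR('a) ^ j)"
    proof
      assume "x ^ (CHAR('a) ^ i) = x ^ (CHAR('a) ^ j)"
      then have "(x ^ (CHAR('a) ^ (j - i))) ^ (CHAR('a) ^ i) = x ^ (CHAR('a) ^ i)"
        using ij by (simp flip: power_mult power_add)
      then have "x \<in> GF (j - i)" unfolding GF_def mem_Collect_eq by (rule inj_power_CHAR)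
      then show False using min[of "j - i"] ij by (metis diff_le_self lessThan_iff order_le_less_trans zero_less_diff)
    qed
  qed auto
  have conj: "conjugates e x = mset_set ((\<lambda>i. x ^ (CHAR('a) ^ i)) ` {..<e})"
    unfolding conjugates_def by (rule image_mset_mset_set[OF inj])
  have x: "x \<in> (\<lambda>i. x ^ (CHAR('a) ^ i)) ` {..<e}"
    using e by (intro image_eqI[of _ _ 0]) auto
  have dvd: "charpoly (e * k) x dvd G \<longleftrightarrow> k \<le> order x G" for k
  proof -
    have "charpoly (e * k) x dvd G \<longleftrightarrow> repeat_mset k (conjugates e x) \<subseteq># proots G"
      using lead_coeff_prod_linear[of "conjugates (e * k) x"] G
      by (subst dvd_iff_proots_subset) (auto simp: conjugates_mult_period[OF e(2)] charpoly_def)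
    also have "\<dots> \<longleftrightarrow> k \<le> order x G"
    proof
      assume "repeat_mset k (conjugates e x) \<subseteq># proots G"
      then have "count (repeat_mset k (conjugates e x)) x \<le> count (proots G) x"
        by (rule mset_subset_eq_count)
      then show "k \<le> order x G" using x G by (simp add: conj)
    next
      assume k: "k \<le> order x G"
      show "repeat_mset k (conjugates e x) \<subseteq># proots G"
      proof (rule mset_subset_eqI)
        fix y
        show "count (repeat_mset k (conjugates e x)) y \<le> count (proots G) y"
          using k G order_conjugate[OF G(3,4) e(2)]
          by (cases "y \<in> (\<lambda>i. x ^ (CHAR('a) ^ i)) ` {..<e}") (auto simp: conj)
      qed
    qed
    finally show ?thesis .
  qed
  have "{n \<in> {1..r}. x \<in> GF n \<and> charpoly n x dvd G} = (\<lambda>k. e * k) ` {1..order x G}"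
  proof (intro equalityI subsetI)
    fix n assume n: "n \<in> {n \<in> {1..r}. x \<in> GF n \<and> charpoly n x dvd G}"
    then obtain k where "n = e * k" using in_GF_iff_dvd_period[OF e(2,1) min] by auto
    with n dvd[of k] show "n \<in> (\<lambda>k. e * k) ` {1..order x G}"
      by (intro image_eqI[of _ _ k]) (cases k; auto)+
  next
    fix n assume "n \<in> (\<lambda>k. e * k) ` {1..order x G}"
    then obtain k where k: "n = e * k" "k \<ge> 1" "k \<le> order x G" using e(1) by fastforce
    then have "charpoly n x dvd G" by (simp add: dvd)
    then have "degree (charpoly n x) \<le> degree G" using G(4) by (rule dvd_imp_degree_le)
    then show "n \<in> {n \<in> {1..r}. x \<in> GF n \<and> charpoly n x dvd G}"
      using k e G in_GF_iff_dvd_period[OF e(2,1) min, of n] dvd by (auto simp: degree_charpoly)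
  qed
  moreover have "inj_on (\<lambda>k. e * k) {1..order x G}" using e by (auto simp: inj_on_def)
  ultimately show ?thesis by (simp add: card_image)
qed

text \<open>Polynomial analogue of \<open>\<Sum> \<Lambda>(d) = log n\<close> over the divisors
  \<open>d\<close> of \<open>n\<close>: each root \<open>x\<close> contributes
  \<open>order x G\<close>, and these add up to the degree.\<close>

lemma card_charpoly_divisor_pairs:
  fixes G :: "'a :: {alg_closed_field, field_prime_char} poly"
  assumes "G \<in> monic_polys r"
  shows "card (SIGMA n:{1..r}. {x \<in> GF n. charpoly n x dvd G}) = r"
proof -
  have G: "degree G = r" "G \<noteq> 0" using assms by (auto simp: monic_polys_def)
  have root: "poly G x = 0" if "n \<ge> 1" "charpoly n x dvd G" for n x
  proof -
    have "x \<in># conjugates n x"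
      using that(1) by (auto simp: conjugates_def intro!: image_eqI[of _ _ 0])
    then have "x \<in># proots (charpoly n x)" by simp
    moreover have "charpoly n x \<noteq> 0"
      using lead_coeff_prod_linear[of "conjugates n x"] by (auto simp: charpoly_def)
    ultimately have "poly (charpoly n x) x = 0" using set_count_proots[of "charpoly n x"] by blast
    then show ?thesis using that(2) by (elim dvdE) simp
  qed
  let ?S = "SIGMA x:set_mset (proots G). {n \<in> {1..r}. x \<in> GF n \<and> charpoly n x dvd G}"
  have "(SIGMA n:{1..r}. {x \<in> GF n. charpoly n x dvd G}) = prod.swap ` ?S"
  proof (intro equalityI subsetI)
    fix z assume "z \<in> (SIGMA n:{1..r}. {x \<in> GF n. charpoly n x dvd G})"
    then have "prod.swap z \<in> ?S" using root G(2) by auto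
    then show "z \<in> prod.swap ` ?S" by (intro image_eqI[of _ _ "prod.swap z"]) auto
  qed auto
  moreover have "card (prod.swap ` ?S) = card ?S"
    by (rule card_image) auto
  moreover have "card ?S = (\<Sum>x\<in>set_mset (proots G). card {n \<in> {1..r}. x \<in> GF n \<and> charpoly n x dvd G})"
    by (rule card_SigmaI) auto
  moreover have "\<dots> = (\<Sum>x\<in>set_mset (proots G). count (proots G) x)"
    using G(2) by (intro sum.cong refl, subst card_charpoly_divisors[OF assms]) auto
  moreover have "\<dots> = r"
    using G size_proots_alg_closed[of G] by (simp add: size_multiset_overloaded_eq)
  ultimately show ?thesis by simp
qed

section \<open>Character sums and the coefficients of the L-function\<close>

definition trace :: "nat \<Rightarrow> 'a :: field_prime_char \<Rightarrow> 'a" where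
  "trace n x = (\<Sum>i<n. x ^ (CHAR('a) ^ i))"

definition char_sum :: "'a :: field_prime_char poly \<Rightarrow> nat \<Rightarrow> complex" where
  "char_sum f n = (\<Sum>x\<in>GF n. add_char (trace n (poly f x)))"

definition root_char :: "'a :: field_prime_char poly \<Rightarrow> 'a poly \<Rightarrow> complex" where
  "root_char f g = add_char (\<Sum>x\<in>#proots g. poly f x)"

text \<open>Coefficient of \<open>T^r\<close> in the L-function, seen as a Dirichlet series over
  monic polynomials with the completely multiplicative weight \<open>root_char f\<close>.\<close>

definition L_coeff :: "'a :: field_prime_char poly \<Rightarrow> nat \<Rightarrow> complex" where
  "L_coeff f r = (\<Sum>g\<in>monic_polys r. root_char f g)"

lemma sum_roots_in_GF:
  fixes f :: "'a :: {alg_closed_field, field_prime_char} poly"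
  assumes "\<forall>i. coeff f i \<in> GF 1" "g \<in> monic_polys r"
  shows "(\<Sum>x\<in>#proots g. poly f x) \<in> GF 1"
  unfolding sum_roots_eq_power_sums
  using assms power_sum_in_GF[OF assms(2)] by (intro GF_sum GF_mult) auto

lemma root_char_mult:
  fixes f :: "'a :: {alg_closed_field, field_prime_char} poly"
  assumes "\<forall>i. coeff f i \<in> GF 1" "g \<in> monic_polys r" "h \<in> monic_polys s"
  shows "root_char f (g * h) = root_char f g * root_char f h"
proof -
  have "g \<noteq> 0" "h \<noteq> 0" using assms by (auto simp: monic_polys_def)
  then show ?thesis
    using sum_roots_in_GF[OF assms(1,2)] sum_roots_in_GF[OF assms(1,3)]
    by (simp add: root_char_def proots_mult add_char_add)
qed

text \<open>Evaluation of \<open>f\<close> commutes with Frobenius, so summing \<open>f\<close> over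
  the conjugates of \<open>x\<close> gives the trace of \<open>f x\<close>: the link between field
  elements and polynomials.\<close>

lemma root_char_charpoly:
  fixes f :: "'a :: field_prime_char poly"
  assumes "\<forall>i. coeff f i \<in> GF 1"
  shows "root_char f (charpoly n x) = add_char (trace n (poly f x))"
  using poly_power_CHAR[OF assms]
  by (simp add: root_char_def conjugates_def trace_def sum_unfold_sum_mset multiset.map_comp o_def)

lemma monic_polys_mult:
  assumes "g \<in> monic_polys r" "h \<in> monic_polys s"
  shows "g * h \<in> monic_polys (r + s)"
proof -
  have "frob_poly g = g" "frob_poly h = h"
    using assms by (auto simp only: monic_polys_def frob_poly_eq_iff)
  then have "frob_poly (g * h) = g * h" by (simp add: frob_poly_mult)
  moreover have "g \<noteq> 0" "h \<noteq> 0" using assms by (auto simp: monic_polys_def)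
  ultimately show ?thesis
    using assms unfolding monic_polys_def frob_poly_eq_iff
    by (auto simp: degree_mult_eq coeff_mult_degree_sum)
qed

lemma monic_polys_cofactor:
  fixes g :: "'a :: field_prime_char poly"
  assumes "g \<in> monic_polys n" "g * h \<in> monic_polys r" "n \<le> r"
  shows "h \<in> monic_polys (r - n)"
proof -
  have nz: "g \<noteq> 0" "h \<noteq> 0" using assms by (auto simp: monic_polys_def)
  have "frob_poly g = g" "frob_poly (g * h) = g * h"
    using assms by (auto simp only: monic_polys_def frob_poly_eq_iff)
  then have "g * frob_poly h = g * h" by (simp add: frob_poly_mult)
  then have "frob_poly h = h" using nz by simp
  moreover have "degree h = r - n" using assms nz by (auto simp: monic_polys_def degree_mult_eq)
  moreover have "lead_coeff h = 1"
    using assms lead_coeff_mult[of g h] by (auto simp: monic_polys_def)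
  ultimately show ?thesis
    unfolding monic_polys_def frob_poly_eq_iff by simp
qed

text \<open>The identity \<open>T L'(T) / L(T) = \<Sum> S\<^sub>n T\<^sup>n\<close>, read off coefficientwise: both sides count the pairs
  \<open>(x, h)\<close> with \<open>charpoly n x * h = G\<close>, of which there are \<open>deg G\<close> for each \<open>G\<close>.\<close>

lemma L_coeff_recurrence:
  fixes f :: "'a :: {alg_closed_field, field_prime_char} poly"
  assumes f: "\<forall>i. coeff f i \<in> GF 1"
  shows "of_nat r * L_coeff f r = (\<Sum>n=1..r. char_sum f n * L_coeff f (r - n))"
proof -
  have inner: "add_char (trace n (poly f x)) * L_coeff f (r - n)
      = (\<Sum>G\<in>monic_polys r. if charpoly n x dvd G then root_char f G else 0)"
    if n: "n \<in> {1..r}" and x: "x \<in> GF n" for n x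
  proof -
    let ?c = "charpoly n x"
    have c: "?c \<in> monic_polys n" using x by (rule charpoly_in_monic_polys)
    have c0: "?c \<noteq> 0" using c by (auto simp: monic_polys_def)
    have bij: "bij_betw (\<lambda>h. ?c * h) (monic_polys (r - n)) {G \<in> monic_polys r. ?c dvd G}"
    proof (rule bij_betw_imageI)
      show "inj_on (\<lambda>h. ?c * h) (monic_polys (r - n))" using c0 by (auto simp: inj_on_def)
      show "(\<lambda>h. ?c * h) ` monic_polys (r - n) = {G \<in> monic_polys r. ?c dvd G}"
        using monic_polys_mult[OF c, of _ "r - n"] monic_polys_cofactor[OF c] n
        by (auto elim!: dvdE)
    qed
    have "add_char (trace n (poly f x)) * L_coeff f (r - n)
        = (\<Sum>h\<in>monic_polys (r - n). root_char f (?c * h))"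
      by (simp add: L_coeff_def sum_distrib_left root_char_mult[OF f c] root_char_charpoly[OF f])
    also have "\<dots> = (\<Sum>G\<in>{G \<in> monic_polys r. ?c dvd G}. root_char f G)"
      by (rule sum.reindex_bij_betw[OF bij])
    also have "\<dots> = (\<Sum>G\<in>monic_polys r. if ?c dvd G then root_char f G else 0)"
      by (rule sum.inter_filter) (rule finite_monic_polys)
    finally show ?thesis .
  qed
  have "(\<Sum>n=1..r. char_sum f n * L_coeff f (r - n))
      = (\<Sum>n=1..r. \<Sum>x\<in>GF n. \<Sum>G\<in>monic_polys r. if charpoly n x dvd G then root_char f G else 0)"
    unfolding char_sum_def sum_distrib_right by (intro sum.cong refl inner)
  also have "\<dots> = (\<Sum>(n, x)\<in>(SIGMA n:{1..r}. GF n). \<Sum>G\<in>monic_polys r. if charpoly n x dvd G then root_char f G else 0)"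
    by (rule sum.Sigma) auto
  also have "\<dots> = (\<Sum>G\<in>monic_polys r. \<Sum>(n, x)\<in>(SIGMA n:{1..r}. GF n). if charpoly n x dvd G then root_char f G else 0)"
    unfolding case_prod_beta by (rule sum.swap)
  also have "\<dots> = (\<Sum>G\<in>monic_polys r. of_nat r * root_char f G)"
  proof (rule sum.cong[OF refl])
    fix G :: "'a poly" assume G: "G \<in> monic_polys r"
    have fin: "finite (SIGMA n:{1..r}. (GF n :: 'a set))" by auto
    have "(\<Sum>(n, x)\<in>(SIGMA n:{1..r}. GF n). if charpoly n x dvd G then root_char f G else 0)
        = (\<Sum>z\<in>{z \<in> (SIGMA n:{1..r}. GF n). charpoly (fst z) (snd z) dvd G}. root_char f G)"
      unfolding case_prod_beta by (rule sum.inter_filter[OF fin, symmetric])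
    also have "{z \<in> (SIGMA n:{1..r}. GF n). charpoly (fst z) (snd z) dvd G}
        = (SIGMA n:{1..r}. {x \<in> GF n. charpoly n x dvd G})" by auto
    finally show "(\<Sum>(n, x)\<in>(SIGMA n:{1..r}. GF n). if charpoly n x dvd G then root_char f G else 0)
        = of_nat r * root_char f G"
      by (simp only: sum_constant card_charpoly_divisor_pairs[OF G])
  qed
  also have "\<dots> = of_nat r * L_coeff f r"
    by (simp add: L_coeff_def sum_distrib_left)
  finally show ?thesis by simp
qed

lemma L_coeff_0: "L_coeff f 0 = 1"
proof -
  have "monic_polys 0 = {1 :: 'a :: field_prime_char poly}"
    by (auto simp: monic_polys_def elim!: degree_eq_zeroE)
  then show ?thesis by (simp add: L_coeff_def root_char_def)
qed

text \<open>Adding \<open>X^(r - degree f)\<close> permutes the monic polynomials of degree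
  \<open>r\<close> and, by \<open>power_sum_shift\<close>, moves the sum of \<open>f\<close> over
  the roots by the fixed nonzero \<open>?w\<close>. The coefficient thus equals itself times
  \<open>add_char ?w\<close>, which is not 1.\<close>

lemma L_coeff_eq_0:
  fixes f :: "'a :: {alg_closed_field, field_prime_char} poly"
  assumes f: "\<forall>i. coeff f i \<in> GF 1" and d: "degree f > 0" "of_nat (degree f) * lead_coeff f \<noteq> 0"
    and r: "degree f \<le> r"
  shows "L_coeff f r = 0"
proof -
  let ?d = "degree f"
  let ?w = "- (of_nat ?d * lead_coeff f)"
  let ?s = "\<lambda>g :: 'a poly. g + monom 1 (r - ?d)"
  have w: "?w \<in> GF 1" using f by (intro GF_uminus GF_mult) auto
  have w1: "add_char ?w \<noteq> 1" using w d by (intro add_char_neq_1) auto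
  have shift: "g + monom t (r - ?d) \<in> monic_polys r" if g: "g \<in> monic_polys r" and "t \<in> GF 1" for g :: "'a poly" and t
    using power_sum_shift(1,2)[of g ?d 0 t] that d r by (auto simp: monic_polys_def intro: GF_add)
  have bij: "bij_betw ?s (monic_polys r) (monic_polys r)"
  proof (rule bij_betw_byWitness[where f' = "\<lambda>g. g + monom (-1) (r - ?d)"])
    show "(?s :: 'a poly \<Rightarrow> 'a poly) ` monic_polys r \<subseteq> monic_polys r" using shift by auto
    show "(\<lambda>g :: 'a poly. g + monom (-1) (r - ?d)) ` monic_polys r \<subseteq> monic_polys r"
      by (intro image_subsetI shift GF_uminus GF_1)
  qed (auto simp: add.assoc add_monom)
  have "root_char f (?s g) = root_char f g * add_char ?w" if g: "g \<in> monic_polys r" for g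
  proof -
    have ps: "power_sum (?s g) n = power_sum g n - (if n = ?d then of_nat ?d else 0)" if "n \<le> ?d" for n
      using power_sum_shift(3)[of g ?d n 1] that g d r by (auto simp: monic_polys_def)
    have "(\<Sum>x\<in>#proots (?s g). poly f x) = (\<Sum>k\<le>?d. coeff f k * power_sum (?s g) k)"
      by (rule sum_roots_eq_power_sums)
    also have "\<dots> = (\<Sum>k\<le>?d. coeff f k * power_sum g k - (if k = ?d then of_nat ?d * lead_coeff f else 0))"
      by (intro sum.cong) (auto simp: ps algebra_simps)
    also have "\<dots> = (\<Sum>x\<in>#proots g. poly f x) + ?w"
      by (simp add: sum_subtractf sum_roots_eq_power_sums)
    finally show ?thesis
      using sum_roots_in_GF[OF f g] w by (simp only: root_char_def add_char_add)
  qed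
  then have "L_coeff f r * add_char ?w = (\<Sum>g\<in>monic_polys r. root_char f (?s g))"
    by (simp add: L_coeff_def sum_distrib_right)
  also have "\<dots> = L_coeff f r"
    unfolding L_coeff_def by (rule sum.reindex_bij_betw[OF bij])
  finally show ?thesis using w1 by (simp add: mult_cancel_left1)
qed

text \<open>Both sequences satisfy the recurrence that Newton's identities give for the reciprocal roots of \<open>L\<close>.\<close>

lemma char_sum_eq_power_sums:
  fixes f :: "'a :: {alg_closed_field, field_prime_char} poly"
  assumes f: "\<forall>i. coeff f i \<in> GF 1" and d: "degree f > 0" "of_nat (degree f) * lead_coeff f \<noteq> 0"
  obtains A :: "complex multiset" where "size A < degree f"
    "\<And>n. n > 0 \<Longrightarrow> char_sum f n = - (\<Sum>\<omega>\<in>#A. \<omega> ^ n)"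
proof -
  define P where "P = (\<Sum>r<degree f. monom (L_coeff f r) r)"
  have P: "coeff P r = L_coeff f r" for r
    using L_coeff_eq_0[OF f d, of r] by (auto simp: P_def coeff_sum)
  have "coeff P 0 = 1" by (simp add: P L_coeff_0)
  \<comment> \<open>\<open>P\<close> has constant term 1, so its reversal is monic, has the
    reciprocal roots of \<open>P\<close> as roots, and reverses back to \<open>P\<close>.\<close>
  define Q where "Q = reflect_poly P"
  have Q: "lead_coeff Q = 1" "reflect_poly Q = P"
    using \<open>coeff P 0 = 1\<close> by (simp_all add: Q_def coeff_reflect_poly)
  have "degree P < degree f" using d(1) by (intro degree_lessI) (auto simp: P L_coeff_eq_0[OF f d])
  then have "size (proots Q) < degree f"
    using degree_reflect_poly_le[of P] by (simp add: size_proots_alg_closed Q_def)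
  moreover have "char_sum f n = - power_sum Q n" if "n > 0" for n
    using that
  proof (induction n rule: less_induct)
    case (less n)
    have "of_nat n * L_coeff f n = (\<Sum>m=1..n. char_sum f m * L_coeff f (n - m))"
      by (rule L_coeff_recurrence[OF f])
    also have "{1..n} = insert n {1..<n}" using less.prems by auto
    also have "(\<Sum>m\<in>insert n {1..<n}. char_sum f m * L_coeff f (n - m))
        = char_sum f n - (\<Sum>m=1..<n. power_sum Q m * L_coeff f (n - m))"
      using less by (simp add: L_coeff_0 sum_negf)
    finally show ?case
      using power_sum_rec[OF Q(1) less.prems] by (simp add: Q(2) P)
  qed
  ultimately show ?thesis by (intro that[of "proots Q"]) (auto simp: power_sum_def)
qed


section \<open>Stepanov's method\<close>

text \<open>A dimension count: more than \<open>B\<close> polynomials in a space of dimension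
  \<open>B\<close>, done by eliminating the top coefficient.\<close>

lemma polys_linearly_dependent:
  fixes g :: "'b \<Rightarrow> 'a :: field poly"
  assumes "finite A" "\<And>a. a \<in> A \<Longrightarrow> degree (g a) < B" "B < card A"
  shows "\<exists>v. (\<exists>a\<in>A. v a \<noteq> 0) \<and> (\<Sum>a\<in>A. smult (v a) (g a)) = 0"
proof -
  \<comment> \<open>Vanishing coefficients replace \<open>degree < B\<close>, which at
    \<open>B = 0\<close> fails even for the zero polynomials that elimination leaves.\<close>
  have "\<exists>v. (\<exists>a\<in>A. v a \<noteq> 0) \<and> (\<Sum>a\<in>A. smult (v a) (g a)) = 0"
    if "finite A" "\<And>a i. a \<in> A \<Longrightarrow> i \<ge> B \<Longrightarrow> coeff (g a) i = 0" "B < card A"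
    for A :: "'b set" and g :: "'b \<Rightarrow> 'a poly" and B
    using that
  proof (induction B arbitrary: A g)
    case 0
    then have "A \<noteq> {}" "\<forall>a\<in>A. g a = 0" by (auto simp: poly_eq_iff)
    then show ?case by (intro exI[of _ "\<lambda>_. 1"]) auto
  next
    case (Suc B)
    show ?case
    proof (cases "\<forall>a\<in>A. coeff (g a) B = 0")
      case True
      have "coeff (g a) i = 0" if "a \<in> A" "i \<ge> B" for a i
        using True Suc.prems(2)[of a i] that by (cases "i = B") auto
      then show ?thesis using Suc.IH[of A g] Suc.prems by auto
    next
      case False
      then obtain b where b: "b \<in> A" "coeff (g b) B \<noteq> 0" by auto
      define c where "c = (\<lambda>a. coeff (g a) B / coeff (g b) B)"
      define h where "h = (\<lambda>a. g a - smult (c a) (g b))"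
      have "coeff (h a) i = 0" if "a \<in> A - {b}" "i \<ge> B" for a i
        using b Suc.prems(2)[of a i] Suc.prems(2)[of b i] that
        by (cases "i = B") (auto simp: h_def c_def)
      moreover have "B < card (A - {b})" using Suc.prems b by auto
      ultimately obtain v where v: "\<exists>a\<in>A - {b}. v a \<noteq> 0" "(\<Sum>a\<in>A - {b}. smult (v a) (h a)) = 0"
        using Suc.IH[of "A - {b}" h] Suc.prems(1) by auto
      define w where "w = v(b := - (\<Sum>a\<in>A - {b}. v a * c a))"
      have "(\<Sum>a\<in>A. smult (w a) (g a)) = smult (w b) (g b) + (\<Sum>a\<in>A - {b}. smult (w a) (g a))"
        using b Suc.prems(1) by (intro sum.remove) auto
      also have "(\<Sum>a\<in>A - {b}. smult (w a) (g a))
          = (\<Sum>a\<in>A - {b}. smult (v a) (h a) + smult (v a * c a) (g b))"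
        by (rule sum.cong) (auto simp: w_def h_def smult_diff_right)
      also have "\<dots> = smult (\<Sum>a\<in>A - {b}. v a * c a) (g b)"
        by (simp add: sum.distrib v(2) smult_sum)
      also have "smult (w b) (g b) + \<dots> = 0"
        by (simp add: w_def)
      finally show ?thesis
        using v(1) by (intro exI[of _ w]) (auto simp: w_def)
    qed
  qed
  moreover have "coeff (g a) i = 0" if "a \<in> A" "i \<ge> B" for a i
    using assms(2)[OF that(1)] that(2) by (intro coeff_eq_0) auto
  ultimately show ?thesis using assms(1,3) by blast
qed

lemma sum_distinct_degrees_nonzero:
  fixes g :: "'b \<Rightarrow> 'a :: field poly"
  assumes "finite A" "\<And>a. a \<in> A \<Longrightarrow> g a \<noteq> 0" "inj_on (\<lambda>a. degree (g a)) A" "b \<in> A" "w b \<noteq> 0"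
  shows "(\<Sum>a\<in>A. smult (w a) (g a)) \<noteq> 0"
proof -
  define S where "S = {a \<in> A. w a \<noteq> 0}"
  have "finite S" "S \<noteq> {}" using assms by (auto simp: S_def)
  then have "Max ((\<lambda>a. degree (g a)) ` S) \<in> (\<lambda>a. degree (g a)) ` S"
    by (intro Max_in) auto
  then obtain m where "m \<in> S" "degree (g m) = Max ((\<lambda>a. degree (g a)) ` S)" by auto
  then have m: "m \<in> S" "\<And>a. a \<in> S \<Longrightarrow> degree (g a) \<le> degree (g m)"
    using \<open>finite S\<close> by auto
  have "coeff (\<Sum>a\<in>A. smult (w a) (g a)) (degree (g m)) = (\<Sum>a\<in>A. w a * coeff (g a) (degree (g m)))"
    by (simp add: coeff_sum)
  also have "\<dots> = (\<Sum>a\<in>{m}. w a * coeff (g a) (degree (g m)))"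
  proof (rule sum.mono_neutral_right)
    show "\<forall>a\<in>A - {m}. w a * coeff (g a) (degree (g m)) = 0"
    proof
      fix a assume a: "a \<in> A - {m}"
      show "w a * coeff (g a) (degree (g m)) = 0"
      proof (cases "w a = 0")
        case False
        then have "degree (g a) \<le> degree (g m)" using a m by (auto simp: S_def)
        moreover have "degree (g a) \<noteq> degree (g m)"
          using assms(3) a m(1) by (auto simp: S_def inj_on_def)
        ultimately show ?thesis by (simp add: coeff_eq_0)
      qed auto
    qed
  qed (use assms m in \<open>auto simp: S_def\<close>)
  also have "\<dots> \<noteq> 0" using m assms(2) by (auto simp: S_def)
  finally show ?thesis by auto
qed

text \<open>The last \<open>n\<close> conjugates are the first \<open>n\<close> raised to the power
  \<open>p^m\<close>. The split \<open>m = n\<close> yields \<open>a = t + t^Q\<close> in Stepanov's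
  argument, \<open>m = 1\<close> the Frobenius invariance of the trace.\<close>

lemma trace_add: "trace (m + n) y = trace m y + trace n y ^ (CHAR('a) ^ m)" for y :: "'a :: field_prime_char"
proof (induction n)
  case 0
  then show ?case by (simp add: trace_def power_0_left)
next
  case (Suc n)
  have "trace (m + Suc n) y = trace (m + n) y + (y ^ (CHAR('a) ^ n)) ^ (CHAR('a) ^ m)"
    by (simp add: trace_def power_add mult.commute flip: power_mult)
  also have "\<dots> = trace m y + (trace n y + y ^ (CHAR('a) ^ n)) ^ (CHAR('a) ^ m)"
    unfolding add_power_CHAR Suc.IH by simp
  finally show ?case by (simp add: trace_def)
qed

lemma degree_sum_frobenius_powers:
  fixes f :: "'a :: field_prime_char poly"
  assumes "degree f > 0"
  shows "degree (\<Sum>i<Suc m. f ^ (CHAR('a) ^ i)) = degree f * CHAR('a) ^ m"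
proof (induction m)
  case (Suc m)
  have "degree (f ^ (CHAR('a) ^ Suc m)) = degree f * CHAR('a) ^ Suc m"
    using assms by (subst degree_power_eq) (auto simp: mult.commute)
  moreover have "degree f * CHAR('a) ^ m < degree f * CHAR('a) ^ Suc m"
    using assms prime_gt_1_nat[OF CHAR_prime[where 'a = 'a]] by simp
  ultimately show ?case
    unfolding sum.lessThan_Suc[of _ "Suc m"] using Suc by (subst degree_add_eq_right) simp_all
qed simp

text \<open>
  The auxiliary polynomial is \<open>H = \<Sum> w\<^sub>k\<^sub>i\<^sub>j x\<^sup>k x\<^sup>i\<^sup>Q t\<^sup>j\<close> with \<open>Q = p\<^sup>m\<^sup>+\<^sup>1\<close> and \<open>t = f + f\<^sup>p + \<dots>\<close> (\<open>m + 1\<close> terms).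
  At a point \<open>x\<close> of the field with \<open>Q\<^sup>2\<close> elements where the trace of \<open>f x\<close> is \<open>a\<close>, we have \<open>t\<^sup>Q = a - t\<close>
  and \<open>x\<^sup>Q\<^sup>Q = x\<close>, so \<open>H\<^sup>Q\<close> takes the same value as a polynomial of degree roughly \<open>Q\<^sup>2 / p\<close>, and
  counting coefficients allows to make that polynomial vanish identically.
  The degrees of the terms of \<open>H\<close> are pairwise distinct because \<open>p\<close> does not divide \<open>degree f\<close>.
\<close>

lemma stepanov_bound:
  fixes f :: "'a :: {alg_closed_field, field_prime_char} poly"
  assumes d: "degree f > 0" "\<not> CHAR('a) dvd degree f"
    and m: "degree f + 1 < CHAR('a) ^ m"
  shows "card {x \<in> GF (2 * Suc m). trace (2 * Suc m) (poly f x) = a}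
           \<le> CHAR('a) ^ (2 * m + 1) + (2 * degree f + 1) * CHAR('a) ^ Suc m"
proof -
  define p where "p = CHAR('a)"
  define d where "d = degree f"
  define s where "s = p ^ m"
  define Q where "Q = p ^ Suc m"
  \<comment> \<open>Least value making the \<open>Q * I\<close> triples outnumber the
    \<open>Q * s + I + d * Q\<close> coefficients available to the \<open>E z\<close>; the
    comparison reduces to \<open>I < Q\<close>.\<close>
  define I where "I = s + d + 1"
  define t where "t = (\<Sum>i<Suc m. f ^ (p ^ i))"
  \<comment> \<open>The ranges make \<open>k\<close> and \<open>j\<close> digits: the degree of
    \<open>F (k, i, j)\<close> is \<open>k + s * (p * i + d * j)\<close>, which gives
    \<open>k\<close> modulo \<open>s\<close> and then \<open>j\<close> modulo
    \<open>p\<close>.\<close>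
  define A where "A = {..<s} \<times> {..<I} \<times> {..<p}"
  define E where "E = (\<lambda>(k, i, j). monom 1 (k * Q + i) * ([:a:] - t) ^ j)"
  define F where "F = (\<lambda>(k, i, j). monom 1 (k + i * Q) * t ^ j)"
  have p: "prime p" "p \<ge> 2" by (auto simp: p_def prime_ge_2_nat)
  have "Q = p * s" by (simp add: Q_def s_def)
  have "s > 0" "Q > 0" using p by (auto simp: s_def Q_def)
  have deg_t: "degree t = d * s"
    using degree_sum_frobenius_powers[OF d(1), of m] by (simp add: t_def d_def s_def p_def)
  have "t \<noteq> 0" using deg_t d(1) \<open>s > 0\<close> by (auto simp: d_def)
  have "finite A" by (simp add: A_def)
  have deg_E: "degree (E z) < Q * s + I + d * Q" if "z \<in> A" for z
  proof -
    obtain k i j where z: "z = (k, i, j)" "k < s" "i < I" "j < p" using \<open>z \<in> A\<close> by (auto simp: A_def)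
    have "degree (E z) \<le> degree (monom 1 (k * Q + i) :: 'a poly) + degree (([:a:] - t) ^ j)"
      by (simp add: E_def z(1) degree_mult_le)
    also have "\<dots> \<le> (k * Q + i) + degree ([:a:] - t) * j"
      by (intro add_mono degree_monom_le degree_power_le)
    also have "degree ([:a:] - t) * j \<le> d * s * p"
      using z deg_t by (intro mult_mono) (auto intro: degree_diff_le)
    also have "k * Q \<le> s * Q" using z by simp
    finally show ?thesis using z(3) by (simp add: \<open>Q = p * s\<close> algebra_simps)
  qed
  have "card A = s * (I * p)" by (simp add: A_def card_cartesian_product)
  also have "\<dots> = Q * s + Q * d + Q" by (simp add: \<open>Q = p * s\<close> I_def algebra_simps)
  finally have card_A: "card A = Q * s + Q * d + Q" .
  have "2 * s \<le> p * s" using p by simp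
  moreover have "d + 1 < s" using m by (simp add: s_def p_def d_def)
  ultimately have "I < Q" unfolding \<open>Q = p * s\<close> I_def by linarith
  then have "Q * s + I + d * Q < card A" by (simp add: card_A mult.commute)
  with deg_E have "\<exists>v. (\<exists>z\<in>A. v z \<noteq> 0) \<and> (\<Sum>z\<in>A. smult (v z) (E z)) = 0"
    by (rule polys_linearly_dependent[OF \<open>finite A\<close>])
  then obtain v where v: "\<exists>z\<in>A. v z \<noteq> 0" "(\<Sum>z\<in>A. smult (v z) (E z)) = 0" by blast
  \<comment> \<open>The relation \<open>v\<close> holds among the \<open>E z\<close>, the reduced
    \<open>Q\<close>-th powers of the \<open>F z\<close>. Taking \<open>Q\<close>-th roots of its
    coefficients, possible in the closed field, makes \<open>H\<close> vanish at the points in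
    question.\<close>
  have "\<exists>w. \<forall>z. w z ^ Q = v z"
    by (intro choice allI nth_root_exists \<open>Q > 0\<close>)
  then obtain w where w: "\<And>z. w z ^ Q = v z" by auto
  define H where "H = (\<Sum>z\<in>A. smult (w z) (F z))"
  have deg_F: "degree (F (k, i, j)) = k + s * (p * i + d * j)" for k i j
    using \<open>t \<noteq> 0\<close> deg_t
    by (simp add: F_def degree_mult_eq degree_power_eq degree_monom_eq \<open>Q = p * s\<close> algebra_simps)
  have "inj_on (\<lambda>z. degree (F z)) A"
  proof (rule inj_onI)
    fix y z assume yz: "y \<in> A" "z \<in> A" "degree (F y) = degree (F z)"
    obtain k i j where y: "y = (k, i, j)" "k < s" "j < p" using yz by (auto simp: A_def)
    obtain k' i' j' where z: "z = (k', i', j')" "k' < s" "j' < p" using yz by (auto simp: A_def)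
    have eq: "k + s * (p * i + d * j) = k' + s * (p * i' + d * j')"
      using yz(3) by (simp add: y z deg_F)
    have "(k + s * (p * i + d * j)) mod s = (k' + s * (p * i' + d * j')) mod s" by (simp only: eq)
    then have "k = k'" using y z by simp
    with eq \<open>s > 0\<close> have eq': "p * i + d * j = p * i' + d * j'" by simp
    have "(p * i + d * j) mod p = (p * i' + d * j') mod p" by (simp only: eq')
    then have "[d * j = d * j'] (mod p)" by (simp add: cong_def)
    moreover have "coprime d p"
      using d(2) p(1) by (simp add: prime_imp_coprime coprime_commute d_def p_def)
    ultimately have "[j = j'] (mod p)" using cong_mult_lcancel_nat by blast
    then have "j = j'" using y z by (simp add: cong_def)
    then show "y = z" using eq' \<open>k = k'\<close> y z p by simp
  qed
  moreover have "F z \<noteq> 0" for z using \<open>t \<noteq> 0\<close> by (auto simp: F_def split: prod.splits)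
  moreover have "\<exists>z\<in>A. w z \<noteq> 0" using v(1) w \<open>Q > 0\<close> by (metis power_0_left not_gr_zero)
  ultimately have "H \<noteq> 0"
    unfolding H_def using sum_distinct_degrees_nonzero[OF \<open>finite A\<close>] by blast
  have "degree (F z) \<le> s * Q + (2 * d + 1) * Q" if "z \<in> A" for z
  proof -
    obtain k i j where z: "z = (k, i, j)" "k < s" "i \<le> s + d" "j < p" using \<open>z \<in> A\<close> by (auto simp: A_def I_def)
    have "degree (F z) = k + Q * i + s * d * j"
      by (simp add: z(1) deg_F \<open>Q = p * s\<close> algebra_simps)
    also have "k \<le> Q" using z(2) \<open>2 * s \<le> p * s\<close> unfolding \<open>Q = p * s\<close> by linarith
    also have "Q + Q * i + s * d * j \<le> Q + Q * (s + d) + s * d * p"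
      using z(3,4) by (intro add_mono mult_left_mono) auto
    finally show ?thesis by (simp add: \<open>Q = p * s\<close> algebra_simps)
  qed
  then have deg_H: "degree H \<le> s * Q + (2 * d + 1) * Q"
    unfolding H_def by (intro degree_sum_le \<open>finite A\<close>) (meson degree_smult_le order_trans)
  have root: "poly H x = 0" if x: "x \<in> GF (2 * Suc m)" "trace (2 * Suc m) (poly f x) = a" for x
  proof -
    have "poly t x = trace (Suc m) (poly f x)"
      by (simp add: t_def trace_def poly_sum p_def)
    moreover have "a = trace (Suc m) (poly f x) + trace (Suc m) (poly f x) ^ Q"
      using trace_add[of "Suc m" "Suc m" "poly f x"] x(2) by (simp add: Q_def p_def mult_2)
    ultimately have t: "poly t x ^ Q = a - poly t x" by simp
    have xQ: "x ^ (Q * Q) = x"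
    proof -
      have "Q * Q = CHAR('a) ^ (2 * Suc m)" by (simp only: Q_def p_def mult_2 power_add)
      then show ?thesis using x(1) by (simp only: GF_def mem_Collect_eq)
    qed
    have "poly H x ^ Q = (\<Sum>z\<in>A. (w z * poly (F z) x) ^ Q)"
      using sum_power_CHAR[of "\<lambda>z. w z * poly (F z) x" A "Suc m"]
      by (simp add: H_def poly_sum Q_def p_def)
    also have "\<dots> = (\<Sum>z\<in>A. v z * poly (E z) x)"
    proof (rule sum.cong[OF refl])
      fix z assume "z \<in> A"
      obtain k i j where z: "z = (k, i, j)" using prod_cases3 by blast
      have "poly (F z) x ^ Q = x ^ (k * Q) * (x ^ (Q * Q)) ^ i * (poly t x ^ Q) ^ j"
        by (simp add: z F_def poly_monom power_mult_distrib power_add algebra_simps flip: power_mult)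
      also have "\<dots> = poly (E z) x"
        by (simp add: z E_def poly_monom power_add xQ t)
      finally show "(w z * poly (F z) x) ^ Q = v z * poly (E z) x"
        by (simp add: power_mult_distrib w)
    qed
    also have "\<dots> = poly (\<Sum>z\<in>A. smult (v z) (E z)) x" by (simp add: poly_sum)
    also have "\<dots> = 0" by (simp add: v(2))
    finally show ?thesis by simp
  qed
  have "card {x \<in> GF (2 * Suc m). trace (2 * Suc m) (poly f x) = a} \<le> card {x. poly H x = 0}"
    using root by (intro card_mono poly_roots_finite[OF \<open>H \<noteq> 0\<close>]) auto
  also have "\<dots> \<le> degree H" by (rule card_poly_roots_bound[OF \<open>H \<noteq> 0\<close>])
  also have "\<dots> \<le> s * Q + (2 * d + 1) * Q" by (rule deg_H)
  \<comment> \<open>This main term is the average number \<open>p^(n - 1)\<close> of points per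
    trace value, \<open>n = 2 * Suc m\<close>, so only the second term is an error.\<close>
  also have "s * Q = p ^ (2 * m + 1)" by (simp add: s_def Q_def mult_2 power_add)
  finally show ?thesis by (simp add: p_def Q_def d_def)
qed

section \<open>From point counts to character sums\<close>

lemma trace_in_GF:
  assumes "y \<in> GF n"
  shows "trace n y \<in> GF 1"
proof -
  \<comment> \<open>The trace of length \<open>n + 1\<close> is split after its first and before its
    last term; the two end terms agree as \<open>y\<close> lies in \<open>GF n\<close>.\<close>
  have "y + trace n y ^ CHAR('a) = trace (1 + n) y"
    unfolding trace_add by (simp add: trace_def)
  also have "\<dots> = trace n y + y"
    using assms by (simp add: trace_def GF_def)
  finally show ?thesis by (simp add: GF_def)
qed

lemma poly_in_GF:
  fixes f :: "'a :: field_prime_char poly"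
  assumes "\<forall>i. coeff f i \<in> GF 1" "x \<in> GF n"
  shows "poly f x \<in> GF n"
  using poly_power_CHAR[OF assms(1), of x n] assms(2) by (simp add: GF_def)

lemma sum_add_char: "(\<Sum>a\<in>GF 1. add_char (a :: 'a :: {alg_closed_field, field_prime_char})) = 0"
proof -
  have "bij_betw (\<lambda>a. a + 1) (GF 1 :: 'a set) (GF 1)"
    by (rule bij_betw_byWitness[where f' = "\<lambda>a. a - 1"]) (auto intro: GF_add GF_diff GF_1)
  then have "(\<Sum>a\<in>GF 1. add_char (a :: 'a)) = (\<Sum>a\<in>GF 1. add_char (a + 1 :: 'a))"
    by (rule sum.reindex_bij_betw[symmetric])
  also have "\<dots> = (\<Sum>a\<in>GF 1. add_char (a :: 'a)) * add_char (1 :: 'a)"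
    unfolding sum_distrib_right by (intro sum.cong refl add_char_add) auto
  finally show ?thesis
    using add_char_neq_1[of "1 :: 'a"] by (simp add: mult_cancel_left1)
qed

text \<open>Since \<open>add_char\<close> sums to zero, the average may be subtracted from the
  counts; the deviations \<open>u a\<close> sum to zero, so their common upper bound
  \<open>C\<close> also controls their absolute values.\<close>

lemma norm_char_sum_le_stepanov:
  fixes f :: "'a :: {alg_closed_field, field_prime_char} poly"
  assumes f: "\<forall>i. coeff f i \<in> GF 1" and d: "degree f > 0" "\<not> CHAR('a) dvd degree f"
    and m: "degree f + 1 < CHAR('a) ^ m"
  shows "cmod (char_sum f (2 * Suc m)) \<le> 2 * CHAR('a) * (2 * degree f + 1) * real CHAR('a) ^ Suc m"
proof -
  let ?n = "2 * Suc m" and ?p = "CHAR('a)"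
  define N where "N = (\<lambda>a. card {x \<in> GF ?n. trace ?n (poly f x) = a})"
  define u where "u = (\<lambda>a. real (N a) - real ?p ^ (2 * m + 1))"
  define C where "C = (2 * degree f + 1) * real ?p ^ Suc m"
  have tr: "trace ?n (poly f x) \<in> GF 1" if "x \<in> GF ?n" for x
    using that by (intro trace_in_GF poly_in_GF[OF f])
  have "char_sum f ?n = (\<Sum>a\<in>GF 1. \<Sum>x\<in>{x \<in> GF ?n. trace ?n (poly f x) = a}. add_char (trace ?n (poly f x)))"
    unfolding char_sum_def by (rule sum.group[symmetric]) (use tr in auto)
  also have "\<dots> = (\<Sum>a\<in>GF 1. add_char a * of_nat (N a))"
    by (intro sum.cong) (auto simp: N_def)
  also have "\<dots> = (\<Sum>a\<in>GF 1. add_char a * of_real (u a)) + (\<Sum>a\<in>GF 1. add_char (a :: 'a)) * of_real (real ?p ^ (2 * m + 1))"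
    by (simp add: u_def sum_distrib_right sum.distrib[symmetric] algebra_simps del: power_Suc)
  finally have "cmod (char_sum f ?n) = cmod (\<Sum>a\<in>GF 1. add_char a * of_real (u a))"
    by (simp only: sum_add_char mult_zero_left add_0_right)
  also have "\<dots> \<le> (\<Sum>a\<in>GF 1. \<bar>u a\<bar>)"
    by (rule order_trans[OF norm_sum]) (simp add: norm_mult)
  also have "\<dots> \<le> (\<Sum>a\<in>GF 1. 2 * C - u a)"
  proof (rule sum_mono)
    fix a :: 'a
    have "real (N a) \<le> real (?p ^ (2 * m + 1) + (2 * degree f + 1) * ?p ^ Suc m)"
      unfolding N_def by (intro of_nat_mono stepanov_bound d m)
    then have "u a \<le> C" by (simp add: u_def C_def algebra_simps)
    moreover have "0 \<le> C" by (simp add: C_def)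
    ultimately show "\<bar>u a\<bar> \<le> 2 * C - u a" by linarith
  qed
  also have "\<dots> = 2 * ?p * C - (\<Sum>a\<in>GF 1. u a)"
    using card_GF[of 1, where 'a = 'a] by (simp add: sum_subtractf)
  also have "(\<Sum>a\<in>GF 1. u a) = 0"
  proof -
    have "(\<Sum>a\<in>GF 1. N a) = (\<Sum>a\<in>GF 1. \<Sum>x\<in>{x \<in> GF ?n. trace ?n (poly f x) = a}. 1)"
      by (simp add: N_def)
    also have "\<dots> = (\<Sum>x\<in>(GF ?n :: 'a set). 1)"
      using tr by (intro sum.group[of "GF ?n" "GF 1" "\<lambda>x. trace ?n (poly f x)" "\<lambda>_. 1"]) auto
    also have "\<dots> = ?p ^ ?n"
      using card_GF[of ?n, where 'a = 'a] by simp
    finally have "(\<Sum>a\<in>GF 1. real (N a)) = real ?p ^ ?n"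
      by (metis of_nat_sum of_nat_power)
    then show ?thesis
      using card_GF[of 1, where 'a = 'a] by (simp add: u_def sum_subtractf)
  qed
  finally show ?thesis by (simp add: C_def algebra_simps)
qed

text \<open>By Dirichlet's theorem there are arbitrarily large even \<open>n\<close> for which all \<open>\<omega>\<^sup>n\<close> lie near the positive real
  axis, so that no cancellation takes place in the power sum.\<close>

lemma power_sum_growth_imp_norm_le:
  fixes A :: "complex multiset"
  assumes bound: "\<And>m. m \<ge> m0 \<Longrightarrow> cmod (\<Sum>z\<in>#A. z ^ (2 * m)) \<le> C * R ^ m" and "R > 0"
    and w: "w \<in># A"
  shows "cmod w \<le> sqrt R"
proof (rule ccontr)
  assume "\<not> cmod w \<le> sqrt R"
  then have "R < (cmod w)\<^sup>2" using \<open>R > 0\<close> real_le_rsqrt not_le by blast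
  then have ratio: "(cmod w)\<^sup>2 / R > 1" using \<open>R > 0\<close> by simp
  obtain K0 where K0: "2 * C < ((cmod w)\<^sup>2 / R) ^ K0" using real_arch_pow[OF ratio] by blast
  define K where "K = Suc (K0 + m0)"
  obtain zs where zs: "A = mset zs" using ex_mset by metis
  \<comment> \<open>If \<open>q * \<theta> l\<close> is nearly an integer, \<open>z^(2 m)\<close>
    with \<open>m = K * q\<close> is nearly real and positive. The factor \<open>K\<close> forces
    \<open>m\<close> to be large, as Dirichlet's theorem only makes \<open>q\<close>
    positive.\<close>
  define \<theta> where "\<theta> = (\<lambda>l. 2 * real K * (Arg (zs ! l) / (2 * pi)))"
  \<comment> \<open>An error below \<open>1/6\<close> of a turn keeps the angle below
    \<open>pi/3\<close>, where the cosine is at least \<open>1/2\<close>.\<close>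
  obtain q h where q: "0 < q"
    and qh: "\<And>l. l < length zs \<Longrightarrow> \<bar>of_int q * \<theta> l - of_int (h l)\<bar> < 1 / real 6"
    by (rule Dirichlet_approx_simult[of 6 "length zs" \<theta>]) (simp, blast)
  define m where "m = K * nat q"
  have "nat q \<ge> 1" using q by linarith
  then have "m \<ge> K" by (simp add: m_def)
  have Re: "Re (z ^ (2 * m)) \<ge> cmod z ^ (2 * m) / 2" if z: "z \<in># A" for z
  proof -
    obtain l where l: "l < length zs" "z = zs ! l" using z zs by (auto simp: in_set_conv_nth)
    define \<delta> where "\<delta> = of_int q * \<theta> l - of_int (h l)"
    have \<delta>: "\<bar>\<delta>\<bar> < 1 / 6" using qh[OF l(1)] by (simp add: \<delta>_def)
    have "z = of_real (cmod z) * cis (Arg z)"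
      using rcis_cmod_Arg[of z] by (simp add: rcis_def)
    then have "z ^ (2 * m) = (of_real (cmod z) * cis (Arg z)) ^ (2 * m)" by (rule arg_cong)
    also have "\<dots> = of_real (cmod z ^ (2 * m)) * cis (real (2 * m) * Arg z)"
      unfolding power_mult_distrib Complex.DeMoivre of_real_power ..
    finally have "z ^ (2 * m) = of_real (cmod z ^ (2 * m)) * cis (real (2 * m) * Arg z)" .
    moreover have "real (2 * m) * Arg z = 2 * pi * \<delta> + 2 * pi * of_int (h l)"
      using q by (simp add: \<delta>_def \<theta>_def m_def l(2) field_simps)
    ultimately have "Re (z ^ (2 * m)) = cmod z ^ (2 * m) * cos (2 * pi * \<delta>)"
      by (simp add: cis_mult[symmetric] cis_multiple_2pi)
    moreover have "cos (2 * pi * \<delta>) \<ge> 1 / 2"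
    proof -
      have "cos (pi / 3) \<le> cos \<bar>2 * pi * \<delta>\<bar>"
        using \<delta> by (intro cos_monotone_0_pi_le) (auto simp: abs_mult field_simps)
      then show ?thesis by (simp add: cos_60)
    qed
    then have "cmod z ^ (2 * m) * (1 / 2) \<le> cmod z ^ (2 * m) * cos (2 * pi * \<delta>)"
      by (intro mult_left_mono) auto
    ultimately show ?thesis by simp
  qed
  have "cmod w ^ (2 * m) / 2 \<le> (\<Sum>z\<in>#A. cmod z ^ (2 * m) / 2)"
  proof -
    obtain B where "A = add_mset w B" using w by (metis insert_DiffM)
    moreover have "0 \<le> (\<Sum>z\<in>#B. cmod z ^ (2 * m) / 2)"
      by (induction B) auto
    ultimately show ?thesis by simp
  qed
  also have "\<dots> \<le> (\<Sum>z\<in>#A. Re (z ^ (2 * m)))"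
    by (rule sum_mset_mono) (rule Re)
  also have "\<dots> = Re (\<Sum>z\<in>#A. z ^ (2 * m))"
    by (induction A) auto
  also have "\<dots> \<le> C * R ^ m"
    using bound[of m] \<open>m \<ge> K\<close> complex_Re_le_cmod[of "\<Sum>z\<in>#A. z ^ (2 * m)"] by (simp add: K_def)
  finally have "cmod w ^ (2 * m) \<le> 2 * C * R ^ m" by simp
  then have "((cmod w)\<^sup>2 / R) ^ m \<le> 2 * C"
    using \<open>R > 0\<close> unfolding power_divide power_mult[symmetric] by (simp add: pos_divide_le_eq)
  moreover have "((cmod w)\<^sup>2 / R) ^ K0 \<le> ((cmod w)\<^sup>2 / R) ^ m"
    using ratio \<open>m \<ge> K\<close> by (intro power_increasing) (auto simp: K_def)
  ultimately show False using K0 by linarith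
qed

lemma weil_bound_alg_closed:
  fixes f :: "'a :: {alg_closed_field, field_prime_char} poly"
  assumes f: "\<forall>i. coeff f i \<in> GF 1" and d: "degree f > 0" "\<not> CHAR('a) dvd degree f"
  shows "cmod (char_sum f 1) \<le> (real (degree f) - 1) * sqrt (real CHAR('a))"
proof -
  have "lead_coeff f \<noteq> 0" using d by auto
  then have "of_nat (degree f) * lead_coeff f \<noteq> 0"
    using d(2) by (simp add: of_nat_eq_0_iff_char_dvd)
  then obtain A :: "complex multiset" where A: "size A < degree f"
    "\<And>n. n > 0 \<Longrightarrow> char_sum f n = - (\<Sum>\<omega>\<in>#A. \<omega> ^ n)"
    using char_sum_eq_power_sums[OF f d(1)] by blast
  have p: "CHAR('a) > 1" using prime_gt_1_nat CHAR_prime by blast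
  define m0 where "m0 = degree f + 2"
  have "cmod w \<le> sqrt (real CHAR('a))" if "w \<in># A" for w
  proof (rule power_sum_growth_imp_norm_le[OF _ _ that])
    fix m assume m: "m \<ge> Suc m0"
    then obtain k where k: "m = Suc k" "k \<ge> m0" by (cases m) auto
    have "degree f + 1 < k" using k by (simp add: m0_def)
    also have "k < CHAR('a) ^ k" using p by (intro power_gt_expt) simp
    finally show "cmod (\<Sum>z\<in>#A. z ^ (2 * m)) \<le> (2 * CHAR('a) * (2 * degree f + 1)) * real CHAR('a) ^ m"
      using norm_char_sum_le_stepanov[OF f d, of k] A(2)[of "2 * m"] by (simp add: k)
  qed (use p in auto)
  then have "(\<Sum>\<omega>\<in>#A. cmod \<omega>) \<le> (\<Sum>\<omega>\<in>#A. sqrt (real CHAR('a)))"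
    by (intro sum_mset_mono)
  moreover have "cmod (\<Sum>\<omega>\<in>#A. \<omega>) \<le> (\<Sum>\<omega>\<in>#A. cmod \<omega>)"
    by (induction A) (auto intro: order_trans[OF norm_triangle_ineq])
  ultimately have "cmod (char_sum f 1) \<le> real (size A) * sqrt (real CHAR('a))"
    using A(2)[of 1] by simp
  also have "\<dots> \<le> (real (degree f) - 1) * sqrt (real CHAR('a))"
    using A(1) by (intro mult_right_mono) auto
  finally show ?thesis .
qed

section \<open>Weil's bound for prime fields\<close>

text \<open>Phrased over the integers so that \<open>p\<close> is a plain number, not tied to a
  type.\<close>

definition weil_bound_at :: "nat \<Rightarrow> bool" where
  "weil_bound_at p \<longleftrightarrow> (\<forall>f :: int poly. degree f > 0 \<longrightarrow> \<not> p dvd degree f \<longrightarrow> \<not> int p dvd lead_coeff f \<longrightarrow>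
     cmod (\<Sum>j<p. cis (2 * pi * real_of_int (poly f (int j)) / real p))
       \<le> (real (degree f) - 1) * sqrt (real p))"

lemma add_char_of_int:
  "add_char (of_int k :: 'a :: field_prime_char) = cis (2 * pi * real_of_int k / real CHAR('a))"
proof -
  have "(of_int k :: 'a) = of_int (k mod int CHAR('a))" by simp
  also have "\<dots> = of_nat (nat (k mod int CHAR('a)))" by (metis CHAR_pos of_int_of_nat_eq of_nat_0_less_iff pos_mod_sign int_nat_eq)
  finally have "add_char (of_int k :: 'a) = cis (2 * pi * real (nat (k mod int CHAR('a))) / real CHAR('a))"
    by (simp only: add_char_of_nat)
  also have "real (nat (k mod int CHAR('a))) = real_of_int (k mod int CHAR('a))" by simp
  also have "cis (2 * pi * real_of_int (k mod int CHAR('a)) / real CHAR('a)) = cis (2 * pi * real_of_int k / real CHAR('a))"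
    by (rule cis_int_cong) (auto simp: cong_def)
  finally show ?thesis .
qed

lemma weil_bound_at_CHAR: "weil_bound_at CHAR('a :: {alg_closed_field, field_prime_char})"
  unfolding weil_bound_at_def
proof (intro allI impI)
  fix f :: "int poly"
  let ?p = "CHAR('a)"
  assume f: "degree f > 0" "\<not> ?p dvd degree f" "\<not> int ?p dvd lead_coeff f"
  define F where "F = (map_poly of_int f :: 'a poly)"
  have coeff_F: "coeff F i = of_int (coeff f i)" for i by (simp add: F_def coeff_map_poly)
  have "coeff F (degree f) \<noteq> 0" using f(3) by (simp add: coeff_F of_int_eq_0_iff_char_dvd)
  then have "degree f \<le> degree F" by (rule le_degree)
  moreover have "degree F \<le> degree f" by (simp add: F_def degree_map_poly_le)
  ultimately have deg: "degree F = degree f" by simp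
  have "inj_on (of_nat :: nat \<Rightarrow> 'a) {..<?p}"
    by (intro inj_onI) (auto simp: of_nat_eq_iff_cong_CHAR cong_def)
  then have "char_sum F 1 = (\<Sum>j<?p. add_char (poly F (of_nat j)))"
    unfolding char_sum_def GF_1_eq by (subst sum.reindex) (auto simp: trace_def)
  also have "\<dots> = (\<Sum>j<?p. cis (2 * pi * real_of_int (poly f (int j)) / real ?p))"
  proof (rule sum.cong[OF refl])
    fix j
    have "poly F (of_nat j) = of_int (poly f (int j))"
      unfolding poly_altdef deg by (simp add: coeff_F)
    then show "add_char (poly F (of_nat j)) = cis (2 * pi * real_of_int (poly f (int j)) / real ?p)"
      by (simp add: add_char_of_int)
  qed
  finally show "cmod (\<Sum>j<?p. cis (2 * pi * real_of_int (poly f (int j)) / real ?p))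
      \<le> (real (degree f) - 1) * sqrt (real ?p)"
    using weil_bound_alg_closed[of F] f by (simp add: deg coeff_F)
qed

text \<open>
  The bound is proved for a type of characteristic \<open>p\<close>, but a type cannot depend on a variable \<open>p\<close>.
  So the type is built over one fixed prime, chosen to be a counterexample if there is any.
\<close>

definition critical_prime :: nat where
  "critical_prime = (SOME p. prime p \<and> (weil_bound_at p \<longrightarrow> (\<forall>p'. prime p' \<longrightarrow> weil_bound_at p')))"

lemma critical_prime:
  "prime critical_prime" "weil_bound_at critical_prime \<Longrightarrow> prime p \<Longrightarrow> weil_bound_at p"
proof -
  \<comment> \<open>Drinker's paradox: a failing prime if there is one, any prime otherwise.\<close>
  have "\<exists>p. prime p \<and> (weil_bound_at p \<longrightarrow> (\<forall>p'. prime p' \<longrightarrow> weil_bound_at p'))"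
    using two_is_prime_nat by blast
  from someI_ex[OF this]
  show "prime critical_prime" "weil_bound_at critical_prime \<Longrightarrow> prime p \<Longrightarrow> weil_bound_at p"
    unfolding critical_prime_def by blast+
qed

typedef critical_residue = "{..<critical_prime}"
  using prime_gt_0_nat[OF critical_prime(1)] by blast

lemma CARD_critical_residue [simp]: "CARD(critical_residue) = critical_prime"
  using type_definition.card[OF type_definition_critical_residue] by simp

instance critical_residue :: prime_card
  by standard (simp add: critical_prime)

theorem weil_bound:
  fixes f :: "int poly"
  assumes "prime p" "degree f > 0" "\<not> p dvd degree f" "\<not> int p dvd lead_coeff f"
  shows "cmod (\<Sum>j<p. cis (2 * pi * real_of_int (poly f (int j)) / real p))
           \<le> (real (degree f) - 1) * sqrt (real p)"
proof -
  have "weil_bound_at CHAR(critical_residue mod_ring alg_closure)"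
    by (rule weil_bound_at_CHAR)
  then have "weil_bound_at critical_prime" by simp
  from critical_prime(2)[OF this assms(1)] show ?thesis
    using assms unfolding weil_bound_at_def by blast
qed

section \<open>Recovery from incoherent samples\<close>

definition gram :: "nat \<Rightarrow> nat \<Rightarrow> freq \<Rightarrow> freq \<Rightarrow> complex" where
  "gram N d k l = (\<Sum>j=1..N. cnj (FX N d j k) * FX N d j l)"

lemma FX_eq_cis: "FX N d j k = cis (2 * pi * dotx N d k j)"
  by (simp add: FX_def cis_conv_exp mult_ac)

lemma gram_diag: "gram N d k k = of_nat N"
  by (simp add: gram_def FX_eq_cis cis_cnj cis_mult)

lemma finite_freqs [simp]: "finite (freqs q d)"
proof (rule finite_subset)
  show "freqs q d \<subseteq> {k. set k \<subseteq> {- int q..int q} \<and> length k = d}"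
    by (auto simp: freqs_def in_set_conv_nth)
qed (rule finite_lists_length_eq, simp)

lemma FXadj_FXmul: "FXadj d N (FXmul q d N z) k = (\<Sum>l\<in>freqs q d. gram N d k l * z l)"
  unfolding FXadj_def FXmul_def gram_def sum_distrib_left sum_distrib_right
  by (subst sum.swap) (simp add: mult.assoc)

lemma FXmul_diff: "FXmul q d N (\<lambda>k. z k - w k) j = FXmul q d N z j - FXmul q d N w j"
  by (simp add: FXmul_def sum_subtractf right_diff_distrib)

lemma FXadj_cong: "(\<And>j. j \<in> {1..N} \<Longrightarrow> r j = s j) \<Longrightarrow> FXadj d N r k = FXadj d N s k"
  unfolding FXadj_def by (intro sum.cong) auto

text \<open>Otherwise moving \<open>z\<close> by \<open>h / N\<close> in coordinate \<open>k\<close>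
  lowers the squared residual by \<open>|h|^2 / N\<close>, the column having squared norm
  \<open>N\<close>.\<close>

lemma least_squares_residual_orthogonal:
  assumes k: "k \<in> freqs q d" "k \<in> L" and "N > 0" and z: "\<forall>k. k \<notin> L \<longrightarrow> z k = 0"
    and min: "\<And>w. \<forall>k. k \<notin> L \<longrightarrow> w k = 0 \<Longrightarrow>
      norm2 N (\<lambda>j. y j - FXmul q d N z j) \<le> norm2 N (\<lambda>j. y j - FXmul q d N w j)"
  shows "FXadj d N (\<lambda>j. y j - FXmul q d N z j) k = 0"
proof -
  define r where "r = (\<lambda>j. y j - FXmul q d N z j)"
  define h where "h = FXadj d N r k"
  define \<delta> where "\<delta> = h / of_nat N"
  define w where "w = z(k := z k + \<delta>)"
  have FXw: "FXmul q d N w j = FXmul q d N z j + FX N d j k * \<delta>" for j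
  proof -
    have "FXmul q d N w j = (\<Sum>l\<in>freqs q d. FX N d j l * z l + (if l = k then FX N d j k * \<delta> else 0))"
      unfolding FXmul_def by (intro sum.cong) (auto simp: w_def algebra_simps)
    then show ?thesis using k(1) by (simp add: sum.distrib FXmul_def)
  qed
  have "(cmod (r j - FX N d j k * \<delta>))\<^sup>2 = (cmod (r j))\<^sup>2 - 2 * Re (cnj \<delta> * (cnj (FX N d j k) * r j)) + (cmod \<delta>)\<^sup>2" for j
  proof -
    have "(cmod (r j - FX N d j k * \<delta>))\<^sup>2
        = (cmod (r j))\<^sup>2 - 2 * Re (cnj (FX N d j k * \<delta>) * r j) + (cmod (FX N d j k * \<delta>))\<^sup>2"
      unfolding cmod_power2 by (simp add: power2_eq_square algebra_simps)
    then show ?thesis by (simp add: FX_eq_cis norm_mult mult_ac)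
  qed
  then have "(\<Sum>j=1..N. (cmod (r j - FX N d j k * \<delta>))\<^sup>2)
      = (\<Sum>j=1..N. (cmod (r j))\<^sup>2) - 2 * (\<Sum>j=1..N. Re (cnj \<delta> * (cnj (FX N d j k) * r j))) + real N * (cmod \<delta>)\<^sup>2"
    by (simp only: sum.distrib sum_subtractf sum_distrib_left[of 2]) simp
  also have "(\<Sum>j=1..N. Re (cnj \<delta> * (cnj (FX N d j k) * r j))) = Re (cnj \<delta> * h)"
    by (simp only: h_def FXadj_def sum_distrib_left Re_sum)
  also have "Re (cnj \<delta> * h) = (cmod h)\<^sup>2 / real N"
    by (simp add: \<delta>_def cmod_power2 power2_eq_square[of "Re h"] power2_eq_square[of "Im h"] add_divide_distrib)
  also have "real N * (cmod \<delta>)\<^sup>2 = (cmod h)\<^sup>2 / real N"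
    using \<open>N > 0\<close> by (simp add: \<delta>_def norm_divide power2_eq_square)
  finally have eq: "(\<Sum>j=1..N. (cmod (r j - FX N d j k * \<delta>))\<^sup>2) = (\<Sum>j=1..N. (cmod (r j))\<^sup>2) - (cmod h)\<^sup>2 / real N"
    by simp
  have "norm2 N r \<le> norm2 N (\<lambda>j. r j - FX N d j k * \<delta>)"
    using min[of w] z k(2) by (simp add: w_def[symmetric] FXw r_def diff_diff_eq) (auto simp: w_def)
  then have "(cmod h)\<^sup>2 / real N \<le> 0" unfolding norm2_def eq real_sqrt_le_iff by simp
  then show ?thesis using \<open>N > 0\<close> by (simp add: divide_le_0_iff h_def r_def)
qed

text \<open>\<open>\<mu>\<close> bounds the unnormalised off-diagonal correlations;
  \<open>incoherent\<close> is Tropp's condition \<open>\<mu> / N < 1 / (2 M - 1)\<close>, in a form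
  that also makes sense for \<open>M = 0\<close>.\<close>

locale incoherent_samples =
  fixes q d N M :: nat and \<mu> :: real
  assumes N_pos: "N > 0" and mu_nonneg: "\<mu> \<ge> 0"
    and coherence: "k \<in> freqs q d \<Longrightarrow> l \<in> freqs q d \<Longrightarrow> k \<noteq> l \<Longrightarrow> cmod (gram N d k l) \<le> \<mu>"
    and incoherent: "(2 * real M - 1) * \<mu> < real N"
begin

lemma correlation_estimate:
  assumes "k \<in> freqs q d"
  shows "cmod (FXadj d N (FXmul q d N z) k - of_nat N * z k) \<le> \<mu> * (norm1 q d z - cmod (z k))"
proof -
  have "FXadj d N (FXmul q d N z) k - of_nat N * z k = (\<Sum>l\<in>freqs q d - {k}. gram N d k l * z l)"
    using assms by (simp add: FXadj_FXmul sum.remove[of _ k] gram_diag)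
  also have "cmod \<dots> \<le> (\<Sum>l\<in>freqs q d - {k}. \<mu> * cmod (z l))"
    using assms by (intro sum_norm_le) (auto simp: norm_mult intro!: mult_right_mono coherence)
  also have "\<dots> = \<mu> * (norm1 q d z - cmod (z k))"
    using assms by (simp add: norm1_def sum.remove[of _ k] sum_distrib_left)
  finally show ?thesis .
qed

text \<open>On a null vector \<open>correlation_estimate\<close> reads
  \<open>(N + \<mu>) |z k| \<le> \<mu> ||z||\<close>; summing over \<open>T\<close> gives the null
  space property in quantitative form.\<close>

lemma null_space_estimate:
  assumes "\<forall>j\<in>{1..N}. FXmul q d N z j = 0" "T \<subseteq> freqs q d" "card T \<le> M"
  shows "(real N + \<mu>) * (\<Sum>k\<in>T. cmod (z k)) \<le> real M * \<mu> * norm1 q d z"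
proof -
  have *: "(real N + \<mu>) * cmod (z k) \<le> \<mu> * norm1 q d z" if "k \<in> freqs q d" for k
  proof -
    have "FXadj d N (FXmul q d N z) k = 0" using assms(1) by (simp add: FXadj_def)
    then show ?thesis
      using correlation_estimate[OF that, of z] by (simp add: norm_mult algebra_simps)
  qed
  have "(real N + \<mu>) * (\<Sum>k\<in>T. cmod (z k)) \<le> (\<Sum>k\<in>T. \<mu> * norm1 q d z)"
    unfolding sum_distrib_left using assms(2) by (intro sum_mono *) auto
  also have "\<dots> \<le> real M * (\<mu> * norm1 q d z)"
    using assms(3) mu_nonneg
    by (auto simp: norm1_def intro!: mult_right_mono mult_nonneg_nonneg sum_nonneg)
  finally show ?thesis by (simp add: mult.assoc)
qed

lemma norm1_split:
  assumes "T \<subseteq> freqs q d"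
  shows "norm1 q d z = (\<Sum>k\<in>T. cmod (z k)) + (\<Sum>k\<in>freqs q d - T. cmod (z k))"
  unfolding norm1_def using assms by (simp add: sum.subset_diff add.commute)

text \<open>Any \<open>M\<close> columns are independent: for a null vector living on
  \<open>T\<close> the estimate compares \<open>norm1\<close> with itself, and
  \<open>M \<mu> < N + \<mu>\<close>.\<close>

lemma sparse_null_vector:
  assumes "\<forall>j\<in>{1..N}. FXmul q d N z j = 0" "T \<subseteq> freqs q d" "card T \<le> M" "\<And>k. k \<notin> T \<Longrightarrow> z k = 0"
  shows "z k = 0"
proof -
  have norm: "norm1 q d z = (\<Sum>k\<in>T. cmod (z k))"
    unfolding norm1_split[OF assms(2)] using assms(4) by simp
  have "real M * \<mu> < real N + \<mu>"
  proof (cases "M = 0")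
    case False
    then have "real M * \<mu> \<le> (2 * real M - 1) * \<mu>" using mu_nonneg by (intro mult_right_mono) auto
    then show ?thesis using incoherent mu_nonneg by linarith
  qed (use N_pos mu_nonneg in auto)
  moreover have "(real N + \<mu>) * norm1 q d z \<le> real M * \<mu> * norm1 q d z"
    using null_space_estimate[OF assms(1-3)] norm by simp
  moreover have "norm1 q d z \<ge> 0" by (simp add: norm1_def sum_nonneg)
  ultimately have "norm1 q d z = 0"
    by (smt (verit) mult_less_cancel_right)
  then have "\<forall>k\<in>T. cmod (z k) = 0"
    unfolding norm using assms(2) finite_subset[OF _ finite_freqs] by (subst (asm) sum_nonneg_eq_0_iff) auto
  then show ?thesis using assms(4) by (cases "k \<in> T") auto
qed

text \<open>The null vector \<open>v = w - c\<close> has less than half of its \<open>norm1\<close>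
  on the support of \<open>c\<close>, so what \<open>w\<close> can save there is outweighed by what
  it has outside.\<close>

lemma norm1_minimal:
  assumes c: "c \<in> sparse_coeffs q d M" and w: "\<forall>k. k \<notin> freqs q d \<longrightarrow> w k = 0"
    and eq: "\<forall>j\<in>{1..N}. FXmul q d N w j = FXmul q d N c j" and "w \<noteq> c"
  shows "norm1 q d c < norm1 q d w"
proof -
  define T where "T = {k \<in> freqs q d. c k \<noteq> 0}"
  define v where "v = (\<lambda>k. w k - c k)"
  have T: "T \<subseteq> freqs q d" "card T \<le> M" using c by (auto simp: T_def sparse_coeffs_def)
  have "FXmul q d N v j = 0" if "j \<in> {1..N}" for j
    using eq that by (simp add: v_def FXmul_diff)
  then have est: "(real N + \<mu>) * (\<Sum>k\<in>T. cmod (v k)) \<le> real M * \<mu> * norm1 q d v"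
    using null_space_estimate T by blast
  obtain k where k: "w k \<noteq> c k" using \<open>w \<noteq> c\<close> by auto
  then have "k \<in> freqs q d" using c w by (cases "k \<in> freqs q d") (auto simp: sparse_coeffs_def)
  then have pos: "norm1 q d v > 0"
    unfolding norm1_def using k by (intro sum_pos2[of _ k]) (auto simp: v_def)
  have "2 * (real M * \<mu>) < real N + \<mu>" using incoherent by (simp add: algebra_simps)
  then have "2 * (real M * \<mu> * norm1 q d v) < (real N + \<mu>) * norm1 q d v"
    using pos by (simp add: mult.assoc[symmetric])
  with est have "(real N + \<mu>) * (2 * (\<Sum>k\<in>T. cmod (v k))) < (real N + \<mu>) * norm1 q d v" by linarith
  then have half: "2 * (\<Sum>k\<in>T. cmod (v k)) < norm1 q d v"
    using mu_nonneg N_pos by (simp add: mult_less_cancel_left)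
  have "norm1 q d c = (\<Sum>k\<in>T. cmod (c k))"
    unfolding norm1_split[OF T(1)] by (auto simp: T_def intro!: sum.neutral)
  also have "\<dots> \<le> (\<Sum>k\<in>T. cmod (w k) + cmod (v k))"
    by (intro sum_mono) (auto simp: v_def, metis norm_minus_commute norm_triangle_sub)
  also have "\<dots> = (\<Sum>k\<in>T. cmod (w k)) + (\<Sum>k\<in>T. cmod (v k))" by (simp add: sum.distrib)
  also have "\<dots> < (\<Sum>k\<in>T. cmod (w k)) + (\<Sum>k\<in>freqs q d - T. cmod (v k))"
    using half unfolding norm1_split[OF T(1), of v] by simp
  also have "(\<Sum>k\<in>freqs q d - T. cmod (v k)) = (\<Sum>k\<in>freqs q d - T. cmod (w k))"
    by (intro sum.cong) (auto simp: v_def T_def)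
  finally show ?thesis unfolding norm1_split[OF T(1), of w] .
qed

text \<open>At the largest entry of \<open>e\<close>, of modulus \<open>m\<close>, the correlation
  is at least \<open>(N - (M - 1) \<mu>) m\<close>, while off \<open>T\<close> it is at most
  \<open>M \<mu> m\<close>; \<open>incoherent\<close> says exactly that the former is
  larger.\<close>

lemma omp_selects_support:
  assumes T: "T \<subseteq> freqs q d" "card T \<le> M" and e: "\<And>k. k \<notin> T \<Longrightarrow> e k = 0" "e k0 \<noteq> 0"
    and kk: "kk \<in> freqs q d"
      "\<And>k. k \<in> freqs q d \<Longrightarrow> cmod (FXadj d N (FXmul q d N e) k) \<le> cmod (FXadj d N (FXmul q d N e) kk)"
  shows "kk \<in> T" "FXadj d N (FXmul q d N e) kk \<noteq> 0"
proof -
  let ?h = "\<lambda>k. FXadj d N (FXmul q d N e) k"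
  have fin: "finite T" using T(1) finite_subset[OF _ finite_freqs] by blast
  have "k0 \<in> T" using e by auto
  define m where "m = Max ((\<lambda>k. cmod (e k)) ` T)"
  have le_m: "cmod (e k) \<le> m" if "k \<in> T" for k using that fin by (simp add: m_def)
  have "m \<in> (\<lambda>k. cmod (e k)) ` T" unfolding m_def using fin \<open>k0 \<in> T\<close> by (intro Max_in) auto
  then obtain k1 where k1: "k1 \<in> T" "cmod (e k1) = m" by auto
  have "m > 0" using le_m[OF \<open>k0 \<in> T\<close>] e(2) by (metis less_le_trans zero_less_norm_iff)
  have norm: "norm1 q d e = (\<Sum>k\<in>T. cmod (e k))"
    unfolding norm1_split[OF T(1)] using e(1) by simp
  also have "\<dots> \<le> real (card T) * m" using le_m by (intro sum_bounded_above) auto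
  also have "\<dots> \<le> real M * m" using T(2) \<open>m > 0\<close> by (intro mult_right_mono) auto
  finally have "norm1 q d e \<le> real M * m" .
  then have mu_norm: "\<mu> * norm1 q d e \<le> \<mu> * (real M * m)" using mu_nonneg by (rule mult_left_mono)
  have "real N * m - cmod (?h k1) \<le> cmod (?h k1 - of_nat N * e k1)"
    using norm_triangle_ineq2[of "of_nat N * e k1" "?h k1"] by (simp add: norm_minus_commute norm_mult k1(2))
  also have "\<dots> \<le> \<mu> * (norm1 q d e - m)"
    using correlation_estimate[of k1 e] k1 T(1) by auto
  finally have "real N * m - \<mu> * (real M * m) + \<mu> * m \<le> cmod (?h k1)"
    using mu_norm by (simp add: algebra_simps)
  moreover have "\<mu> * (real M * m) < real N * m - \<mu> * (real M * m) + \<mu> * m"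
    using mult_strict_right_mono[OF incoherent \<open>m > 0\<close>] by (simp add: algebra_simps)
  moreover have "cmod (?h k1) \<le> cmod (?h kk)" using kk(2) k1(1) T(1) by blast
  ultimately have large: "\<mu> * (real M * m) < cmod (?h kk)" by linarith
  show "kk \<in> T"
  proof (rule ccontr)
    assume "kk \<notin> T"
    then have "cmod (?h kk) \<le> \<mu> * norm1 q d e"
      using correlation_estimate[OF kk(1), of e] e(1) by simp
    with mu_norm large show False by linarith
  qed
  have "0 \<le> \<mu> * (real M * m)" using mu_nonneg \<open>m > 0\<close> by simp
  with large show "?h kk \<noteq> 0" by auto
qed

text \<open>Until the support is exhausted each step adds a new element of it. Later selections may
  be arbitrary, but at most \<open>M\<close> indices are ever chosen, so least squares on them has
  only the solution \<open>c\<close>.\<close>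

lemma omp_exact:
  assumes c: "c \<in> sparse_coeffs q d M" and y: "\<forall>j\<in>{1..N}. y j = FXmul q d N c j"
    and run: "omp_run q d N M y Lam kk cc"
  shows "cc M = c"
proof -
  define T where "T = {k \<in> freqs q d. c k \<noteq> 0}"
  have T: "T \<subseteq> freqs q d" "card T \<le> M" "\<And>k. k \<notin> T \<Longrightarrow> c k = 0"
    using c by (auto simp: T_def sparse_coeffs_def)
  have finT: "finite T" using T(1) finite_subset[OF _ finite_freqs] by blast
  let ?r = "\<lambda>l j. y j - FXmul q d N (cc l) j"
  have init: "Lam 0 = {}" "cc 0 = (\<lambda>_. 0)" using run by (auto simp: omp_run_def)
  have step: "kk l \<in> freqs q d"
    "\<And>k. k \<in> freqs q d \<Longrightarrow> cmod (FXadj d N (?r l) k) \<le> cmod (FXadj d N (?r l) (kk l))"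
    "Lam (Suc l) = insert (kk l) (Lam l)" "\<forall>k. k \<notin> Lam (Suc l) \<longrightarrow> cc (Suc l) k = 0"
    "\<And>z. \<forall>k. k \<notin> Lam (Suc l) \<longrightarrow> z k = 0 \<Longrightarrow> norm2 N (?r (Suc l)) \<le> norm2 N (\<lambda>j. y j - FXmul q d N z j)"
    if "l < M" for l
    using run that unfolding omp_run_def Let_def by blast+
  have residual: "FXadj d N (?r l) k = FXadj d N (FXmul q d N (\<lambda>k. c k - cc l k)) k" for l k
    using y by (intro FXadj_cong) (simp add: FXmul_diff)
  have inv: "finite (Lam l) \<and> Lam l \<subseteq> freqs q d \<and> card (Lam l) \<le> l \<and> (\<forall>k. k \<notin> Lam l \<longrightarrow> cc l k = 0) \<and>
      (T \<subseteq> Lam l \<or> (Lam l \<subseteq> T \<and> card (Lam l) = l))" if "l \<le> M" for l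
    using that
  proof (induction l)
    case 0
    then show ?case by (simp add: init)
  next
    case (Suc l)
    then have l: "l < M" and IH: "finite (Lam l)" "Lam l \<subseteq> freqs q d" "card (Lam l) \<le> l"
      "\<forall>k. k \<notin> Lam l \<longrightarrow> cc l k = 0" "T \<subseteq> Lam l \<or> (Lam l \<subseteq> T \<and> card (Lam l) = l)" by auto
    note st = step[OF l]
    have "card (Lam (Suc l)) \<le> Suc l" using IH by (simp add: st(3) card_insert_if)
    moreover have "T \<subseteq> Lam (Suc l) \<or> (Lam (Suc l) \<subseteq> T \<and> card (Lam (Suc l)) = Suc l)"
    proof (cases "T \<subseteq> Lam l")
      case True
      then show ?thesis by (auto simp: st(3))
    next
      case False
      with IH have sub: "Lam l \<subseteq> T" "card (Lam l) = l" by auto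
      obtain k0 where k0: "k0 \<in> T" "k0 \<notin> Lam l" using False by auto
      define e where "e = (\<lambda>k. c k - cc l k)"
      have "e k = 0" if "k \<notin> T" for k using that sub T(3) IH(4) by (auto simp: e_def)
      moreover have "e k0 \<noteq> 0" using k0 IH(4) by (simp add: e_def T_def)
      ultimately have sel: "kk l \<in> T" "FXadj d N (?r l) (kk l) \<noteq> 0"
        using omp_selects_support[OF T(1,2), of e k0 "kk l"] st(1,2) by (simp_all add: residual e_def)
      \<comment> \<open>Chosen columns are orthogonal to a least-squares residual, whereas the
        selected correlation is nonzero. \<open>l = 0\<close> is excluded by
        \<open>Lam 0 = {}\<close>.\<close>
      have "kk l \<notin> Lam l"
      proof
        assume "kk l \<in> Lam l"
        then obtain l' where l': "l = Suc l'" using init by (cases l) auto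
        with l have "l' < M" by simp
        from least_squares_residual_orthogonal[OF st(1) \<open>kk l \<in> Lam l\<close> N_pos IH(4), of y]
        show False using sel(2) step(5)[OF \<open>l' < M\<close>] unfolding l' by blast
      qed
      then show ?thesis using sub sel(1) IH(1) by (auto simp: st(3))
    qed
    ultimately show ?case using IH(1,2) st by simp
  qed
  have final: "finite (Lam M)" "Lam M \<subseteq> freqs q d" "card (Lam M) \<le> M" "\<forall>k. k \<notin> Lam M \<longrightarrow> cc M k = 0"
    and "T \<subseteq> Lam M \<or> (Lam M \<subseteq> T \<and> card (Lam M) = M)"
    using inv[of M] by auto
  then have "T \<subseteq> Lam M"
    using T(2) finT by (metis card_seteq order_refl)
  show ?thesis
  proof (cases M)
    case 0
    then have "c = (\<lambda>_. 0)" using T finT by auto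
    then show ?thesis using init 0 by simp
  next
    case (Suc l)
    have "\<forall>k. k \<notin> Lam M \<longrightarrow> c k = 0" using T(3) \<open>T \<subseteq> Lam M\<close> by blast
    then have "norm2 N (?r M) \<le> norm2 N (\<lambda>j. y j - FXmul q d N c j)"
      using step(5)[of l c] Suc by simp
    also have "\<dots> = 0" using y by (simp add: norm2_def)
    finally have "(\<Sum>j=1..N. (cmod (?r M j))\<^sup>2) \<le> 0" by (simp add: norm2_def)
    then have "(\<Sum>j=1..N. (cmod (?r M j))\<^sup>2) = 0" by (intro antisym sum_nonneg) auto
    then have "\<forall>j\<in>{1..N}. ?r M j = 0" by (subst (asm) sum_nonneg_eq_0_iff) auto
    then have "\<forall>j\<in>{1..N}. FXmul q d N (\<lambda>k. c k - cc M k) j = 0" using y by (simp add: FXmul_diff)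
    then have "c k - cc M k = 0" for k
      using sparse_null_vector[of "\<lambda>k. c k - cc M k" "Lam M" k] final \<open>\<forall>k. k \<notin> Lam M \<longrightarrow> c k = 0\<close> by simp
    then show ?thesis by auto
  qed
qed

end

section \<open>Coherence of the sampling matrix via exponential sums\<close>

lemma FX_eq_cis_int:
  assumes "N > 0"
  shows "FX N d j k = cis (2 * pi * real_of_int (\<Sum>i<d. k ! i * int (j ^ Suc i)) / real N)"
proof -
  have "2 * pi * dotx N d k j = 2 * pi * real_of_int (\<Sum>i<d. k ! i * int (j ^ Suc i mod N)) / real N"
    by (simp add: dotx_def node_def sum_divide_distrib sum_distrib_left del: power_Suc)
  \<comment> \<open>Integer frequencies make the reduction of the powers modulo \<open>N\<close>
    invisible.\<close>
  moreover have "[(\<Sum>i<d. k ! i * int (j ^ Suc i mod N)) = (\<Sum>i<d. k ! i * int (j ^ Suc i))] (mod int N)"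
    by (intro cong_sum cong_mult cong_refl) (simp add: cong_def zmod_int del: power_Suc)
  ultimately show ?thesis
    using cis_int_cong assms by (simp only: FX_eq_cis)
qed

definition diff_poly :: "nat \<Rightarrow> freq \<Rightarrow> freq \<Rightarrow> int poly" where
  "diff_poly d k l = (\<Sum>i<d. monom (l ! i - k ! i) (Suc i))"

lemma gram_eq_exponential_sum:
  assumes "N > 0"
  shows "gram N d k l = (\<Sum>j<N. cis (2 * pi * real_of_int (poly (diff_poly d k l) (int j)) / real N))"
proof -
  let ?e = "\<lambda>j. cis (2 * pi * real_of_int (poly (diff_poly d k l) (int j)) / real N)"
  have "cnj (FX N d j k) * FX N d j l = ?e j" for j
  proof -
    have "poly (diff_poly d k l) (int j) = (\<Sum>i<d. l ! i * int (j ^ Suc i)) - (\<Sum>i<d. k ! i * int (j ^ Suc i))"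
      by (simp add: diff_poly_def poly_sum poly_monom sum_subtractf left_diff_distrib del: power_Suc)
    then show ?thesis
      using assms(1) by (simp add: FX_eq_cis_int cis_cnj cis_mult diff_divide_distrib right_diff_distrib del: power_Suc of_int_sum)
  qed
  then have "gram N d k l = (\<Sum>j=1..N. ?e j)" by (simp add: gram_def)
  also have "{1..N} = insert N {1..<N}" using assms(1) by auto
  also have "(\<Sum>j\<in>insert N {1..<N}. ?e j) = ?e N + (\<Sum>j=1..<N. ?e j)" by simp
  \<comment> \<open>The samples run over \<open>1..N\<close>, the complete sum over
    \<open>0..N-1\<close>; periodicity modulo \<open>N\<close> moves the endpoint.\<close>
  also have "?e N = ?e 0"
  proof (rule cis_int_cong)
    show "[poly (diff_poly d k l) (int N) = poly (diff_poly d k l) (int 0)] (mod int N)"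
      by (simp add: diff_poly_def poly_sum poly_monom cong_0_iff dvd_sum)
  qed fact
  also have "?e 0 + (\<Sum>j=1..<N. ?e j) = (\<Sum>j\<in>insert 0 {1..<N}. ?e j)" by simp
  also have "insert 0 {1..<N} = {..<N}" using assms(1) by auto
  finally show ?thesis .
qed

text \<open>Weil's bound applies: the leading coefficient is a nonzero difference of frequencies of
  size at most \<open>2 q < N\<close>, and \<open>N\<close> cannot divide the degree, which is at
  most \<open>d\<close>. The absolute value keeps the bound nonnegative at
  \<open>d = 0\<close>.\<close>

lemma gram_coherence:
  assumes "prime N" and N: "2 * int q + 1 \<le> int N" "(int d - 1)\<^sup>2 + 1 \<le> int N"
    and kl: "k \<in> freqs q d" "l \<in> freqs q d" "k \<noteq> l"
  shows "cmod (gram N d k l) \<le> \<bar>real d - 1\<bar> * sqrt (real N)"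
proof -
  define f where "f = diff_poly d k l"
  have coeff_f: "coeff f n = (if 1 \<le> n \<and> n \<le> d then l ! (n - 1) - k ! (n - 1) else 0)" for n
  proof (cases n)
    case (Suc m)
    have "coeff f n = (\<Sum>i<d. if i = m then l ! i - k ! i else 0)"
      unfolding f_def diff_poly_def coeff_sum Suc by (intro sum.cong) auto
    then show ?thesis by (simp add: Suc Suc_le_eq)
  qed (simp add: f_def diff_poly_def coeff_sum)
  have "length k = d" "length l = d" using kl by (auto simp: freqs_def)
  then obtain i where i: "i < d" "k ! i \<noteq> l ! i" using kl(3) by (metis nth_equalityI)
  then have "coeff f (Suc i) \<noteq> 0" by (simp add: coeff_f)
  then have "f \<noteq> 0" by auto
  then have lead: "lead_coeff f \<noteq> 0" by simp
  then have deg: "1 \<le> degree f" "degree f \<le> d" unfolding coeff_f by (auto split: if_splits)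
  let ?i = "degree f - 1"
  have "?i < d" using deg by simp
  then have bounds: "- int q \<le> k ! ?i" "k ! ?i \<le> int q" "- int q \<le> l ! ?i" "l ! ?i \<le> int q"
    using kl by (auto simp: freqs_def)
  have lead_eq: "lead_coeff f = l ! ?i - k ! ?i" using deg by (simp add: coeff_f)
  have "\<not> int N dvd lead_coeff f"
  proof
    assume "int N dvd lead_coeff f"
    with lead have "int N \<le> \<bar>lead_coeff f\<bar>" using dvd_imp_le_int[of "lead_coeff f" "int N"] by simp
    then show False using bounds N(1) unfolding lead_eq by linarith
  qed
  moreover have "\<not> N dvd degree f"
  proof
    assume "N dvd degree f"
    then have "N \<le> degree f" using deg by (intro dvd_imp_le) auto
    then have "N \<le> d" using deg by simp
    \<comment> \<open>\<open>q > 0\<close> forces \<open>N \<ge> 3\<close>; this excludes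
      \<open>d = N = 2\<close>, the one case that the quadratic bound on a prime \<open>N\<close>
      would permit.\<close>
    have "q > 0"
    proof (rule ccontr)
      assume "\<not> q > 0"
      then show False using lead bounds unfolding lead_eq by simp
    qed
    then have "d \<ge> 3" using N(1) \<open>N \<le> d\<close> by simp
    then have "2 * (int d - 1) \<le> (int d - 1)\<^sup>2"
      unfolding power2_eq_square by (intro mult_right_mono) auto
    then show False using N(2) \<open>N \<le> d\<close> \<open>d \<ge> 3\<close> by simp
  qed
  ultimately have "cmod (\<Sum>j<N. cis (2 * pi * real_of_int (poly f (int j)) / real N))
      \<le> (real (degree f) - 1) * sqrt (real N)"
    using weil_bound[of N f] assms(1) deg by simp
  also have "\<dots> \<le> \<bar>real d - 1\<bar> * sqrt (real N)"
    using deg by (intro mult_right_mono) auto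
  finally show ?thesis
    using prime_gt_0_nat[OF assms(1)] by (simp add: gram_eq_exponential_sum f_def)
qed

text \<open>Comparison of squares: the \<open>+ 1\<close> supplies strictness, and a negative
  left-hand side, possible at \<open>M = 0\<close>, does no harm.\<close>

lemma coherence_threshold:
  fixes d M N :: nat
  assumes "(int d - 1)\<^sup>2 * (2 * int M - 1)\<^sup>2 + 1 \<le> int N"
  shows "(2 * real M - 1) * (\<bar>real d - 1\<bar> * sqrt (real N)) < real N"
proof -
  let ?a = "(2 * real M - 1) * (\<bar>real d - 1\<bar> * sqrt (real N))"
  have "real_of_int ((int d - 1)\<^sup>2 * (2 * int M - 1)\<^sup>2 + 1) \<le> real_of_int (int N)"
    using assms by (simp only: of_int_le_iff)
  then have le: "(real d - 1)\<^sup>2 * (2 * real M - 1)\<^sup>2 < real N" by simp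
  then have pos: "0 < real N" by (smt (verit) mult_nonneg_nonneg zero_le_power2)
  have "?a\<^sup>2 = ((real d - 1)\<^sup>2 * (2 * real M - 1)\<^sup>2) * real N"
    by (simp add: power_mult_distrib)
  also have "\<dots> < (real N)\<^sup>2"
    using le pos by (simp add: power2_eq_square[of "real N"])
  finally show ?thesis by (rule power2_less_imp_less) simp
qed

theorem mainTheorem2:
  fixes q d M N :: nat and c :: "freq \<Rightarrow> complex" and y :: "nat \<Rightarrow> complex"
  assumes "prime N"
    and "int N \<ge> 2 * int q + 1"
    and "int N \<ge> (int d - 1)\<^sup>2 * (2 * int M - 1)\<^sup>2 + 1"
    and "c \<in> sparse_coeffs q d M"
    and "\<forall>j\<in>{1..N}. y j = trig_poly q d c (node N j)"
  shows "(\<forall>Lam kk cc. omp_run q d N M y Lam kk cc \<longrightarrow> cc M = c)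
       \<and> bp_solution q d N y c \<and> (\<forall>z. bp_solution q d N y z \<longrightarrow> z = c)"
proof -
  \<comment> \<open>The base is odd, hence nonzero also at \<open>M = 0\<close>; dropping this
    factor leaves the bound on \<open>N\<close> used for coherence.\<close>
  have "1 \<le> (2 * int M - 1)\<^sup>2"
  proof -
    have "2 * int M - 1 \<noteq> 0" by presburger
    then have "0 < (2 * int M - 1)\<^sup>2" by simp
    then show ?thesis by linarith
  qed
  then have "(int d - 1)\<^sup>2 * 1 \<le> (int d - 1)\<^sup>2 * (2 * int M - 1)\<^sup>2" by (rule mult_left_mono) simp
  then have N2: "(int d - 1)\<^sup>2 + 1 \<le> int N" using assms(3) by linarith
  interpret incoherent_samples q d N M "\<bar>real d - 1\<bar> * sqrt (real N)"
  proof
    show "N > 0" using assms(1) by (rule prime_gt_0_nat)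
  qed (use assms(1-3) N2 in \<open>auto intro: gram_coherence coherence_threshold\<close>)
  have y: "\<forall>j\<in>{1..N}. y j = FXmul q d N c j"
    using assms(5) by (simp add: trig_poly_def FXmul_def FX_def dotx_def mult.commute)
  have feasible: "\<forall>k. k \<notin> freqs q d \<longrightarrow> c k = 0" using assms(4) by (simp add: sparse_coeffs_def)
  have less: "norm1 q d c < norm1 q d w"
    if "\<forall>k. k \<notin> freqs q d \<longrightarrow> w k = 0" "\<forall>j\<in>{1..N}. FXmul q d N w j = y j" "w \<noteq> c" for w
    using norm1_minimal[OF assms(4) that(1) _ that(3)] that(2) y by simp
  have "bp_solution q d N y c"
    unfolding bp_solution_def using feasible y less by (metis order_less_imp_le order_refl)
  moreover have "z = c" if z: "bp_solution q d N y z" for z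
  proof (rule ccontr)
    assume "z \<noteq> c"
    with z have "norm1 q d c < norm1 q d z" unfolding bp_solution_def by (intro less) auto
    moreover have "norm1 q d z \<le> norm1 q d c" using z feasible y unfolding bp_solution_def by auto
    ultimately show False by simp
  qed
  ultimately show ?thesis using omp_exact[OF assms(4) y] by blast
qed

end
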